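(* Let $\mathcal{F}$ be a family of abelian varieties over number fields satisfying the following two conditions. (P1): for every prime $p$ and every $N \in \mathbb{Z}^+$ there is $n = n(p,N) \in \mathbb{Z}^+$ such that for all $A_{/F} \in \mathcal{F}$, if $A(F)$ has a point of order $p^n$ then $p^N \mid [F:\mathbb{Q}]$. (P2): there is $c \in \mathbb{Z}^+$ such that for every prime $p$ and every $A_{/F} \in \mathcal{F}$, if $A(F)$ has a point of order $p$ then $\frac{[F:\mathbb{Q}]}{(p-1)/c} \in \mathbb{Z}$. Then: (a) for each $\epsilon > 0$ there is $B_\epsilon \in \mathbb{Z}^+$ such that the set \[ \{ d \in \mathbb{Z}^+ \mid \exists\, A_{/F} \in \mathcal{F} \text{ with } [F:\mathbb{Q}] = d \text{ and } \exp A(F)[\mathrm{tors}] \geq B_\epsilon \} \] has upper density at most $\epsilon$; (b) for each $g \in \mathbb{Z}^+$, letting $\mathcal{F}_g$ be the set of elements of $\mathcal{F}$ of dimension $g$, torsion is typically bounded on $\mathcal{F}_g$: for each $\epsilon>0$ there is $B_\epsilon\in\mathbb{Z}^+$ such that the set of $d\in\mathbb{Z}^+$ for which some $A_{/F}\in\mathcal{F}_g$ with $[F:\mathbb{Q}]=d$ has $\#A(F)[\mathrm{tors}]\ge B_\epsilon$ has upper density at most $\epsilon$.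
   Context: A family of abelian varieties is a class of abelian varieties each defined over some number field, closed under isomorphism over the field of definition. For $\mathcal{S} \subset \mathbb{Z}^+$, the upper density is $\limsup_{x\to\infty} \#(\mathcal{S}\cap[1,x])/x$. $\exp$ denotes the exponent of a finite abelian group. *)

theory Defs
  imports "HOL-Algebra.Algebra" "HOL-Library.Liminf_Limsup" "HOL-Library.Extended_Real"
begin

text \<open>Abstract model of an abelian variety A over a number field F: we record only
  the degree [F:Q], the dimension g, and the finite abelian group A(F)[tors].
  Abelian varieties themselves are not available in Isabelle/HOL; the one geometric
  input about A(F)[tors] that is recorded is A[n] being a subgroup of (Z/nZ)^(2g),
  i.e. the n-torsion of A(F)[tors] has at most n^(2g) elements.\<close>

definition av_torsion_group :: "'b monoid \<Rightarrow> nat \<Rightarrow> bool" where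
  "av_torsion_group G g \<longleftrightarrow> comm_group G \<and> finite (carrier G) \<and>
     (\<forall>n>0. card {x \<in> carrier G. x [^]\<^bsub>G\<^esub> n = \<one>\<^bsub>G\<^esub>} \<le> n ^ (2 * g))"

definition has_point_of_order :: "'b monoid \<Rightarrow> nat \<Rightarrow> bool" where
  "has_point_of_order G m \<longleftrightarrow> (\<exists>x \<in> carrier G. group.ord G x = m)"

definition group_exponent :: "'b monoid \<Rightarrow> nat" where
  "group_exponent G = Lcm ((group.ord G) ` carrier G)"

definition upper_density :: "nat set \<Rightarrow> ereal" where
  "upper_density S = limsup (\<lambda>x::nat. ereal (real (card (S \<inter> {1..x})) / real x))"

end

theory Submission
  imports Defs "HOL-Real_Asymp.Real_Asymp" "HOL-Analysis.Harmonic_Numbers" "HOL-Analysis.Infinite_Products"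
    "HOL-Number_Theory.Cong" "HOL-Computational_Algebra.Squarefree"
begin

text \<open>
  The heart of the matter is a theorem of Erdos and Wagstaff: for large \<open>T\<close>, few integers \<open>d\<close> are
  divisible by \<open>p - 1\<close> for some prime \<open>p > T\<close>. If \<open>d = (p - 1) m\<close> with \<open>log log p\<close> about \<open>V\<close>, then
  \<open>p - 1\<close> and \<open>m\<close> typically have about \<open>V\<close> small prime factors each, whereas a typical \<open>d\<close> has only
  \<open>V\<close> of them. Cutting at \<open>3/2 V\<close>, the \<open>d\<close> with too many prime factors are bounded by Rankin's trick,
  and the pairs \<open>(p - 1, m)\<close> with too few by Brun's sieve with multiplicative weights. Both bounds decay
  exponentially in \<open>V\<close>, hence are summable over doubly exponential ranges of \<open>p\<close>.

  Granting this, (P2) removes all primes \<open>p > T\<close> from the torsion orders outside a sparse set of degrees,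
  and (P1) bounds the power of each of the finitely many primes \<open>p \<le> T\<close> at the cost of the degrees
  divisible by \<open>p ^ N\<close> with \<open>N\<close> large.
\<close>

subsection \<open>Brun's sieve with weights\<close>

text \<open>The expansion of the product of \<open>1 + g q\<close> over \<open>P\<close>, cut off
  above degree \<open>K\<close>; for \<open>g = - f\<close> this is truncated
  inclusion-exclusion.\<close>

definition trunc_sum :: "nat \<Rightarrow> ('a \<Rightarrow> real) \<Rightarrow> 'a set \<Rightarrow> real" where
  "trunc_sum K g P = (\<Sum>D | D \<subseteq> P \<and> card D \<le> K. \<Prod>q\<in>D. g q)"

lemma trunc_sum_0: "finite P \<Longrightarrow> trunc_sum 0 g P = 1"
proof -
  assume "finite P"
  then have "{D. D \<subseteq> P \<and> card D \<le> 0} = {{}}" by (auto simp: finite_subset)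
  then show ?thesis by (simp add: trunc_sum_def)
qed

lemma trunc_sum_empty: "trunc_sum K g {} = 1"
proof -
  have "{D. D \<subseteq> {} \<and> card D \<le> K} = {{} :: 'a set}" by auto
  then show ?thesis unfolding trunc_sum_def by (simp only:) simp
qed

text \<open>Subsets are sorted by whether they contain \<open>q\<close>; removing it lowers the
  degree, hence the smaller index in the last term. The inductions on \<open>P\<close> below run on
  this recursion, with \<open>K\<close> kept arbitrary.\<close>

lemma trunc_sum_insert:
  assumes "finite P" "q \<notin> P"
  shows "trunc_sum (Suc K) g (insert q P) = trunc_sum (Suc K) g P + g q * trunc_sum K g P"
proof -
  let ?A = "{D. D \<subseteq> P \<and> card D \<le> Suc K}" and ?B = "{D. D \<subseteq> P \<and> card D \<le> K}"
  have fB: "finite D" "q \<notin> D" if "D \<in> ?B" for D using that assms finite_subset by auto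
  have fin: "finite ?A" "finite ?B" using assms by auto
  have split: "{D. D \<subseteq> insert q P \<and> card D \<le> Suc K} = ?A \<union> insert q ` ?B"
  proof (intro equalityI subsetI)
    fix D assume D: "D \<in> {D. D \<subseteq> insert q P \<and> card D \<le> Suc K}"
    show "D \<in> ?A \<union> insert q ` ?B"
    proof (cases "q \<in> D")
      case True
      have "finite D" using D assms finite_subset by auto
      then have "D - {q} \<in> ?B" using D True by (auto simp: subset_insert_iff)
      then show ?thesis using True by (intro UnI2 image_eqI[of _ _ "D - {q}"]) auto
    qed (use D in auto)
  next
    fix D assume "D \<in> ?A \<union> insert q ` ?B"
    then show "D \<in> {D. D \<subseteq> insert q P \<and> card D \<le> Suc K}"
    proof
      assume "D \<in> insert q ` ?B"
      then obtain E where "D = insert q E" "E \<in> ?B" by blast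
      then show ?thesis using card_insert_le_m1[of "Suc K" E q] by auto
    qed auto
  qed
  have "inj_on (insert q) ?B" using assms by (auto simp: inj_on_def)
  then have "(\<Sum>D\<in>insert q ` ?B. \<Prod>r\<in>D. g r) = (\<Sum>D\<in>?B. \<Prod>r\<in>insert q D. g r)"
    by (subst sum.reindex) auto
  also have "\<dots> = (\<Sum>D\<in>?B. g q * (\<Prod>r\<in>D. g r))"
    using fB by (intro sum.cong) auto
  finally have "(\<Sum>D\<in>insert q ` ?B. \<Prod>r\<in>D. g r) = g q * trunc_sum K g P"
    by (simp add: trunc_sum_def sum_distrib_left)
  moreover have "?A \<inter> insert q ` ?B = {}" using assms by auto
  ultimately show ?thesis unfolding trunc_sum_def split using fin by (subst sum.union_disjoint) auto
qed

text \<open>The sign \<open>(-1) ^ K\<close> lets both parities be treated at once. Adding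
  \<open>q\<close> turns the signed error into the one at level \<open>k + 1\<close> plus
  \<open>f q\<close> times the one at level \<open>k\<close>: the minus sign in \<open>- f q\<close>
  absorbs the change of parity.\<close>

lemma bonferroni:
  assumes "finite P" "\<And>q. q \<in> P \<Longrightarrow> 0 \<le> f q \<and> f q \<le> 1"
  shows "0 \<le> (-1) ^ K * (trunc_sum K (\<lambda>q. - f q) P - (\<Prod>q\<in>P. 1 - f q))"
  using assms
proof (induction P arbitrary: K rule: finite_induct)
  case empty
  then show ?case by (simp add: trunc_sum_empty)
next
  case (insert q P)
  show ?case
  proof (cases K)
    case 0
    have "(\<Prod>q\<in>insert q P. 1 - f q) \<le> 1" using insert.prems by (intro prod_le_1) auto
    then show ?thesis using 0 insert.hyps by (simp add: trunc_sum_0)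
  next
    case (Suc k)
    let ?R = "\<Prod>q\<in>P. 1 - f q" and ?T = "\<lambda>k. trunc_sum k (\<lambda>q. - f q) P"
    have IH: "0 \<le> (-1) ^ k * (?T k - ?R)" for k using insert by blast
    have "0 \<le> f q * ((-1) ^ k * (?T k - ?R))" using IH[of k] insert.prems[of q] by (meson insertI1 mult_nonneg_nonneg)
    then have "0 \<le> (-1) ^ Suc k * (?T (Suc k) - ?R) + f q * ((-1) ^ k * (?T k - ?R))"
      using IH[of "Suc k"] by linarith
    also have "\<dots> = (-1) ^ Suc k * (?T (Suc k) - f q * ?T k - (1 - f q) * ?R)"
      by (simp add: algebra_simps)
    finally show ?thesis using insert.hyps Suc by (simp add: trunc_sum_insert)
  qed
qed

text \<open>Rankin's trick: a term that is kept has degree at most \<open>K\<close>, so multiplying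
  it by \<open>u\<close> to the power \<open>K\<close> minus its degree only enlarges it; the
  expansion may then be completed to the full product. The sieve remainder is bounded this way with
  \<open>u = z\<close>.\<close>

lemma trunc_sum_le:
  assumes "finite P" "\<And>q. q \<in> P \<Longrightarrow> 0 \<le> g q" "1 \<le> u"
  shows "trunc_sum K g P \<le> u ^ K * (\<Prod>q\<in>P. 1 + g q / u)"
  using assms(1,2)
proof (induction P arbitrary: K rule: finite_induct)
  case empty
  then show ?case using assms(3) by (simp add: trunc_sum_empty)
next
  case (insert q P)
  have g: "0 \<le> g r" if "r \<in> insert q P" for r using insert.prems that by blast
  show ?case
  proof (cases K)
    case 0
    have "1 \<le> (\<Prod>q\<in>insert q P. 1 + g q / u)" using g assms(3) by (intro prod_ge_1) auto
    then show ?thesis using 0 insert.hyps by (simp add: trunc_sum_0)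
  next
    case (Suc k)
    let ?R = "\<Prod>q\<in>P. 1 + g q / u"
    have "trunc_sum (Suc k) g P + g q * trunc_sum k g P \<le> u ^ Suc k * ?R + g q * (u ^ k * ?R)"
      using insert.IH[OF g] g[of q] by (intro add_mono mult_left_mono) (blast+)
    also have "\<dots> = u ^ Suc k * ((1 + g q / u) * ?R)" using assms(3) by (simp add: field_simps)
    finally show ?thesis using insert.hyps Suc by (simp add: trunc_sum_insert)
  qed
qed

lemma abs_prod_minus_1_le:
  fixes g :: "'a \<Rightarrow> real"
  assumes "finite P"
  shows "\<bar>(\<Prod>q\<in>P. 1 + g q) - 1\<bar> \<le> (\<Prod>q\<in>P. 1 + \<bar>g q\<bar>) - 1"
  using assms
proof (induction P rule: finite_induct)
  case (insert q P)
  let ?R = "\<Prod>q\<in>P. 1 + g q" and ?S = "\<Prod>q\<in>P. 1 + \<bar>g q\<bar>"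
  have "\<bar>?R\<bar> \<le> ?S" unfolding abs_prod by (intro prod_mono) auto
  then have "\<bar>g q * ?R\<bar> \<le> \<bar>g q\<bar> * ?S" by (simp add: abs_mult mult_left_mono)
  then show ?case using insert by (simp add: algebra_simps)
qed simp

text \<open>Rankin's trick in the other direction: a discarded term has degree above
  \<open>K\<close>, so weighting it by \<open>u\<close> to its degree and dividing by
  \<open>u ^ K\<close> only enlarges its absolute value.\<close>

lemma trunc_sum_tail:
  assumes "finite P" "1 \<le> u"
  shows "\<bar>trunc_sum K g P - (\<Prod>q\<in>P. 1 + g q)\<bar> \<le> (\<Prod>q\<in>P. 1 + u * \<bar>g q\<bar>) / u ^ K"
  using assms(1)
proof (induction P arbitrary: K rule: finite_induct)
  case empty
  then show ?case using assms(2) by (simp add: trunc_sum_empty)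
next
  case (insert q P)
  show ?case
  proof (cases K)
    case 0
    let ?Q = "insert q P"
    have fin: "finite ?Q" using insert.hyps by simp
    have "\<bar>(\<Prod>q\<in>?Q. 1 + g q) - 1\<bar> \<le> (\<Prod>q\<in>?Q. 1 + \<bar>g q\<bar>) - 1"
      by (rule abs_prod_minus_1_le[OF fin])
    also have "(\<Prod>q\<in>?Q. 1 + \<bar>g q\<bar>) \<le> (\<Prod>q\<in>?Q. 1 + u * \<bar>g q\<bar>)"
      using assms(2) by (intro prod_mono conjI add_mono order_refl mult_right_mono[of 1 u, simplified]) auto
    finally show ?thesis using 0 fin by (simp add: trunc_sum_0)
  next
    case (Suc k)
    let ?R = "\<Prod>q\<in>P. 1 + g q" and ?T = "\<lambda>k. trunc_sum k g P" and ?U = "\<Prod>q\<in>P. 1 + u * \<bar>g q\<bar>"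
    have "\<bar>(?T (Suc k) - ?R) + g q * (?T k - ?R)\<bar> \<le> \<bar>?T (Suc k) - ?R\<bar> + \<bar>g q\<bar> * \<bar>?T k - ?R\<bar>"
      by (metis abs_mult abs_triangle_ineq)
    also have "\<dots> \<le> ?U / u ^ Suc k + \<bar>g q\<bar> * (?U / u ^ k)"
      using insert.IH by (intro add_mono mult_left_mono) (blast | simp)+
    also have "\<dots> = (1 + u * \<bar>g q\<bar>) * ?U / u ^ Suc k" using assms(2) by (simp add: field_simps)
    finally show ?thesis using insert.hyps Suc by (simp add: trunc_sum_insert algebra_simps)
  qed
qed

section \<open>Counting integers in residue classes\<close>

lemma card_residue_class:
  fixes Q c N :: nat
  assumes "Q > 0"
  shows "\<bar>real (card {n \<in> {1..N}. n mod Q = c mod Q}) - real N / real Q\<bar> \<le> 1"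
proof -
  define r where "r = c mod Q"
  have r: "r < Q" using assms by (simp add: r_def)
  define k where "k = N div Q"
  define s where "s = N mod Q"
  have N: "N = k * Q + s" and s: "s < Q" using assms by (auto simp: k_def s_def)
  have NQ: "real N / real Q = real k + real s / real Q" using assms N by (simp add: field_simps)
  have sQ: "0 \<le> real s / real Q" "real s / real Q < 1" using s assms by auto
  have set: "{n \<in> {1..N}. n mod Q = r} = (\<lambda>j. r + j * Q) ` {j. 1 \<le> r + j * Q \<and> r + j * Q \<le> N}"
  proof (intro equalityI subsetI)
    fix n assume n: "n \<in> {n \<in> {1..N}. n mod Q = r}"
    then have "n = r + (n div Q) * Q" using div_mult_mod_eq[of n Q] by simp
    then show "n \<in> (\<lambda>j. r + j * Q) ` {j. 1 \<le> r + j * Q \<and> r + j * Q \<le> N}"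
      using n by (intro image_eqI[of _ _ "n div Q"]) auto
  qed (use r in auto)
  have "inj_on (\<lambda>j. r + j * Q) {j. 1 \<le> r + j * Q \<and> r + j * Q \<le> N}"
    using assms by (auto simp: inj_on_def)
  then have card: "card {n \<in> {1..N}. n mod Q = r} = card {j. 1 \<le> r + j * Q \<and> r + j * Q \<le> N}"
    unfolding set by (rule card_image)
  have up: "j \<le> k" if "r + j * Q \<le> N" for j
  proof (rule ccontr)
    assume "\<not> j \<le> k"
    then have "(k + 1) * Q \<le> j * Q" by (intro mult_right_mono) auto
    then show False using that N s by auto
  qed
  have lo: "r + j * Q \<le> N" if "j < k" for j
  proof -
    have "(j + 1) * Q \<le> k * Q" using that by (intro mult_right_mono) auto
    then show ?thesis using r N by auto
  qed
  \<comment> \<open>The interval starts at 1, so for \<open>r = 0\<close> the index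
    \<open>j = 0\<close> is lost and exactly \<open>k\<close> indices remain; for
    \<open>r > 0\<close> all indices below \<open>k\<close> count and only \<open>j = k\<close> is
    in doubt.\<close>
  show ?thesis
  proof (cases "r = 0")
    case True
    have "{j. 1 \<le> r + j * Q \<and> r + j * Q \<le> N} = {1..k}"
    proof (intro equalityI subsetI)
      fix j assume "j \<in> {j. 1 \<le> r + j * Q \<and> r + j * Q \<le> N}"
      then show "j \<in> {1..k}" using up True by (cases j) auto
    next
      fix j assume "j \<in> {1..k}"
      then have "j * Q \<le> k * Q" "1 \<le> j * Q" using assms by auto
      then have "j * Q \<le> N" "1 \<le> j * Q" unfolding N by linarith+
      then show "j \<in> {j. 1 \<le> r + j * Q \<and> r + j * Q \<le> N}" using True by auto
    qed
    then show ?thesis using card sQ NQ by (simp add: r_def)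
  next
    case False
    have "{..<k} \<subseteq> {j. 1 \<le> r + j * Q \<and> r + j * Q \<le> N}" "{j. 1 \<le> r + j * Q \<and> r + j * Q \<le> N} \<subseteq> {..k}"
      using up lo False by auto
    then have "k \<le> card {j. 1 \<le> r + j * Q \<and> r + j * Q \<le> N}" "card {j. 1 \<le> r + j * Q \<and> r + j * Q \<le> N} \<le> k + 1"
      by (metis card_mono card_lessThan finite_atMost finite_subset, metis card_mono card_atMost finite_atMost Suc_eq_plus1)
    then show ?thesis using card sQ NQ unfolding r_def[symmetric] by linarith
  qed
qed

text \<open>The Chinese remainder theorem merges the two divisibilities into one residue class
  modulo \<open>a * b\<close>.\<close>

lemma card_dvd_dvd_Suc:
  fixes a b N :: nat
  assumes "coprime a b" "a > 0" "b > 0"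
  shows "\<bar>real (card {n \<in> {1..N}. a dvd n + 1 \<and> b dvd n}) - real N / (real a * real b)\<bar> \<le> 1"
proof -
  obtain c where c: "[c = a - 1] (mod a)" "[c = 0] (mod b)"
    using binary_chinese_remainder_nat[OF assms(1)] by blast
  have "a dvd n + 1 \<longleftrightarrow> [n = c] (mod a)" for n
  proof -
    have "a dvd n + 1 \<longleftrightarrow> [n + 1 = a - 1 + 1] (mod a)" using assms by (simp add: cong_def mod_eq_0_iff_dvd)
    also have "\<dots> \<longleftrightarrow> [n = a - 1] (mod a)" by (rule cong_add_rcancel_nat)
    also have "\<dots> \<longleftrightarrow> [n = c] (mod a)" using c by (meson cong_sym cong_trans)
    finally show ?thesis .
  qed
  moreover have "b dvd n \<longleftrightarrow> [n = c] (mod b)" for n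
    using c by (metis cong_0_iff cong_sym cong_trans)
  ultimately have "a dvd n + 1 \<and> b dvd n \<longleftrightarrow> n mod (a * b) = c mod (a * b)" for n
    using assms(1) by (metis cong_def coprime_cong_mult_nat cong_modulus_mult_nat mult.commute)
  then show ?thesis using card_residue_class[of "a * b" N c] assms by simp
qed

lemma prime_prods_coprime:
  assumes "finite A" "finite B" "A \<inter> B = {}" "\<And>q. q \<in> A \<union> B \<Longrightarrow> Factorial_Ring.prime (q::nat)"
  shows "coprime (\<Prod>A) (\<Prod>B)"
proof (intro prod_coprime_left prod_coprime_right)
  fix p q assume "p \<in> A" "q \<in> B"
  then show "coprime p q" using assms primes_coprime by (metis UnI1 UnI2 disjoint_iff)
qed

lemma prime_prod_dvd_iff:
  assumes "finite A" "\<And>q. q \<in> A \<Longrightarrow> Factorial_Ring.prime (q::nat)"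
  shows "\<Prod>A dvd n \<longleftrightarrow> (\<forall>q\<in>A. q dvd n)"
  using assms
proof (induction A rule: finite_induct)
  case (insert q A)
  have "coprime (\<Prod>{q}) (\<Prod>A)" using insert by (intro prime_prods_coprime) auto
  then show ?case using insert by (auto intro: divides_mult dest: dvd_mult_left dvd_mult_right)
qed auto

text \<open>Expanding the product assigns each \<open>q\<close> in \<open>D\<close> to one of two
  classes; \<open>A\<close> collects those with \<open>q dvd n + 1\<close>. Each assignment is one
  residue class modulo the product of \<open>D\<close>, counted up to an error of 1, and the weights
  \<open>w A\<close> of these errors add up to the right-hand side.\<close>

lemma sieve_moment:
  fixes \<alpha> \<beta> :: real
  assumes D: "finite D" "\<And>q. q \<in> D \<Longrightarrow> Factorial_Ring.prime (q::nat)" and ab: "0 \<le> \<alpha>" "0 \<le> \<beta>"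
  shows "\<bar>(\<Sum>n=1..N. \<Prod>q\<in>D. \<alpha> * of_bool (q dvd n + 1) + \<beta> * of_bool (q dvd n))
          - real N * (\<Prod>q\<in>D. (\<alpha> + \<beta>) / real q)\<bar> \<le> (\<alpha> + \<beta>) ^ card D"
proof -
  define w where "w A = (\<alpha> ^ card A * \<beta> ^ card (D - A) :: real)" for A
  define cnt where "cnt A = card {n \<in> {1..N}. \<Prod>A dvd n + 1 \<and> \<Prod>(D - A) dvd n}" for A
  have w0: "0 \<le> w A" for A using ab by (simp add: w_def)
  have w: "(\<Sum>A\<in>Pow D. w A) = (\<alpha> + \<beta>) ^ card D"
    using prod_add[OF D(1), of "\<lambda>_. \<alpha>" "\<lambda>_. \<beta>"] by (simp add: w_def)
  have ind: "(\<Prod>q\<in>A. of_bool (q dvd m)) = (of_bool (\<Prod>A dvd m) :: real)" if "A \<subseteq> D" for A m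
  proof -
    have "(\<Prod>q\<in>A. of_bool (q dvd m)) = (of_bool (\<forall>q\<in>A. q dvd m) :: real)"
      using finite_subset[OF that D(1)] by (induction A rule: finite_induct) auto
    moreover have "\<Prod>A dvd m \<longleftrightarrow> (\<forall>q\<in>A. q dvd m)"
      using that D finite_subset by (intro prime_prod_dvd_iff) auto
    ultimately show ?thesis by simp
  qed
  have "(\<Prod>q\<in>D. \<alpha> * of_bool (q dvd n + 1) + \<beta> * of_bool (q dvd n))
        = (\<Sum>A\<in>Pow D. w A * of_bool (\<Prod>A dvd n + 1 \<and> \<Prod>(D - A) dvd n))" for n
    unfolding prod_add[OF D(1)] by (intro sum.cong refl) (simp add: prod.distrib ind w_def)
  then have "(\<Sum>n=1..N. \<Prod>q\<in>D. \<alpha> * of_bool (q dvd n + 1) + \<beta> * of_bool (q dvd n))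
        = (\<Sum>A\<in>Pow D. \<Sum>n=1..N. w A * of_bool (\<Prod>A dvd n + 1 \<and> \<Prod>(D - A) dvd n))"
    by (simp add: sum.swap[of _ "Pow D"])
  also have "\<dots> = (\<Sum>A\<in>Pow D. w A * real (cnt A))"
    by (simp add: cnt_def sum_distrib_left[symmetric] sum.inter_filter[symmetric] flip: of_nat_sum)
       (simp add: Int_def)
  finally have lhs: "(\<Sum>n=1..N. \<Prod>q\<in>D. \<alpha> * of_bool (q dvd n + 1) + \<beta> * of_bool (q dvd n))
        = (\<Sum>A\<in>Pow D. w A * real (cnt A))" .
  have rhs: "real N * (\<Prod>q\<in>D. (\<alpha> + \<beta>) / real q) = (\<Sum>A\<in>Pow D. w A * (real N / (\<Prod>q\<in>D. real q)))"
    by (simp add: prod_dividef w flip: sum_distrib_right sum_divide_distrib)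
  have cnt: "\<bar>real (cnt A) - real N / (\<Prod>q\<in>D. real q)\<bar> \<le> 1" if "A \<in> Pow D" for A
  proof -
    have fin: "finite A" "finite (D - A)" using that D finite_subset by auto
    have pos: "\<Prod>A > 0" "\<Prod>(D - A) > 0" using D that fin prime_gt_0_nat by (auto intro!: prod_pos)
    have "(\<Prod>q\<in>D. real q) = real (\<Prod>A) * real (\<Prod>(D - A))"
      using prod.subset_diff[of A D real] that D by (simp add: mult.commute)
    moreover have "coprime (\<Prod>A) (\<Prod>(D - A))" using fin that D by (intro prime_prods_coprime) auto
    ultimately show ?thesis unfolding cnt_def using card_dvd_dvd_Suc[OF _ pos] by simp
  qed
  have "\<bar>\<Sum>A\<in>Pow D. w A * (real (cnt A) - real N / (\<Prod>q\<in>D. real q))\<bar>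
        \<le> (\<Sum>A\<in>Pow D. w A * 1)"
    by (rule order.trans[OF sum_abs], rule sum_mono)
       (use w0 cnt in \<open>auto simp: abs_mult intro!: mult_left_le\<close>)
  then show ?thesis unfolding lhs rhs by (simp add: w right_diff_distrib sum_subtractf)
qed

lemma sum_trunc_sum_swap:
  "(\<Sum>n\<in>A. trunc_sum K (g n) P) = (\<Sum>D | D \<subseteq> P \<and> card D \<le> K. \<Sum>n\<in>A. \<Prod>q\<in>D. g n q)"
  unfolding trunc_sum_def by (rule sum.swap)

lemma prod_minus: "(\<Prod>q\<in>D. - g q) = (-1) ^ card D * (\<Prod>q\<in>D. g q :: real)"
  using prod.distrib[of "\<lambda>_. -1" g D] by simp

text \<open>The residue classes sieved out are \<open>-1\<close> with weight \<open>\<alpha>\<close> and \<open>0\<close> with weight \<open>\<beta>\<close>: with \<open>n = p - 1\<close>,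
  \<open>\<alpha> = 1\<close> forces \<open>p\<close> to be free of small primes, and \<open>\<beta> < 1\<close> dampens \<open>n\<close> by \<open>1 - \<beta>\<close> for each of its prime
  factors.\<close>

lemma brun_sieve:
  fixes \<alpha> \<beta> :: real and z N K :: nat
  assumes P: "P \<subseteq> {..z}" "\<And>q. q \<in> P \<Longrightarrow> Factorial_Ring.prime q"
    and \<alpha>: "0 \<le> \<alpha>" "\<alpha> \<le> 1" and \<beta>: "0 \<le> \<beta>" "\<beta> \<le> 1"
    and K: "even K" "9 * (\<Sum>q\<in>P. 1 / real q) \<le> real K" and z: "2 \<le> z" "z ^ (2 * K) \<le> N"
  shows "(\<Sum>n=1..N. \<Prod>q\<in>P. 1 - (\<alpha> * of_bool (q dvd n + 1) + \<beta> * of_bool (q dvd n)))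
          \<le> 10 * real N * exp (- (\<alpha> + \<beta>) * (\<Sum>q\<in>P. 1 / real q))"
proof -
  define \<sigma> where "\<sigma> = \<alpha> + \<beta>"
  define V where "V = (\<Sum>q\<in>P. 1 / real q)"
  define a where "a n q = \<alpha> * of_bool (q dvd n + 1) + \<beta> * of_bool (q dvd n)" for n q :: nat
  define b where "b q = \<sigma> / real q" for q :: nat
  have fin: "finite P" using P(1) finite_subset by blast
  have \<sigma>: "0 \<le> \<sigma>" "\<sigma> \<le> 2" using \<alpha> \<beta> by (auto simp: \<sigma>_def)
  have q2: "2 \<le> q" if "q \<in> P" for q using P(2)[OF that] prime_ge_2_nat by blast
  have V0: "0 \<le> V" by (simp add: V_def sum_nonneg)
  have \<sigma>V: "0 \<le> \<sigma> * V" "\<sigma> * V \<le> 2 * V" using \<sigma> V0 by (auto intro: mult_right_mono)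
  have K9: "9 * V \<le> real K" using K by (simp add: V_def)
  \<comment> \<open>No prime divides both \<open>n\<close> and \<open>n + 1\<close>, so the two
    weights are never added.\<close>
  have a01: "0 \<le> a n q \<and> a n q \<le> 1" if "q \<in> P" for n q
  proof -
    have "\<not> (q dvd n + 1 \<and> q dvd n)"
      using P(2)[OF that] by (metis dvd_add_right_iff not_prime_1 nat_dvd_1_iff_1)
    then show ?thesis using \<alpha> \<beta> by (auto simp: a_def)
  qed
  have b01: "0 \<le> b q" "b q \<le> 1" if "q \<in> P" for q using q2[OF that] \<sigma> by (auto simp: b_def)
  have sumb: "(\<Sum>q\<in>P. b q) = \<sigma> * V" by (simp add: b_def V_def sum_distrib_left)
  have "(\<Sum>n=1..N. \<Prod>q\<in>P. 1 - a n q) \<le> (\<Sum>n=1..N. trunc_sum K (\<lambda>q. - a n q) P)"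
    using bonferroni[OF fin a01, of _ K] K(1) by (intro sum_mono) simp
  also have "\<dots> = (\<Sum>D | D \<subseteq> P \<and> card D \<le> K. (-1) ^ card D * (\<Sum>n=1..N. \<Prod>q\<in>D. a n q))"
    by (simp add: sum_trunc_sum_swap prod_minus sum_distrib_left)
  also have "\<dots> \<le> (\<Sum>D | D \<subseteq> P \<and> card D \<le> K. (-1) ^ card D * (real N * (\<Prod>q\<in>D. b q)) + \<sigma> ^ card D)"
  proof (rule sum_mono)
    fix D assume "D \<in> {D. D \<subseteq> P \<and> card D \<le> K}"
    then have D: "finite D" "\<And>q. q \<in> D \<Longrightarrow> Factorial_Ring.prime q" using P fin finite_subset by auto
    have "\<bar>(\<Sum>n=1..N. \<Prod>q\<in>D. a n q) - real N * (\<Prod>q\<in>D. b q)\<bar> \<le> \<sigma> ^ card D"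
      using sieve_moment[OF D \<alpha>(1) \<beta>(1), of N] by (simp add: a_def b_def \<sigma>_def)
    moreover have "(-1) ^ card D = (1 :: real) \<or> (-1) ^ card D = (-1 :: real)" by (cases "even (card D)") auto
    ultimately show "(-1) ^ card D * (\<Sum>n=1..N. \<Prod>q\<in>D. a n q) \<le> (-1) ^ card D * (real N * (\<Prod>q\<in>D. b q)) + \<sigma> ^ card D"
      by (auto simp: abs_le_iff)
  qed
  also have "\<dots> = real N * trunc_sum K (\<lambda>q. - b q) P + trunc_sum K (\<lambda>_. \<sigma>) P"
    by (simp add: trunc_sum_def sum.distrib prod_minus sum_distrib_left mult_ac)
  finally have 1: "(\<Sum>n=1..N. \<Prod>q\<in>P. 1 - a n q) \<le> real N * trunc_sum K (\<lambda>q. - b q) P + trunc_sum K (\<lambda>_. \<sigma>) P" .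
  have e8: "exp 2 \<le> (8 :: real)"
  proof -
    have "exp 2 = exp 1 * (exp 1 :: real)" by (simp flip: exp_add)
    also have "\<dots> \<le> 272/100 * (272/100)" using e_less_272 by (intro mult_mono) auto
    finally show ?thesis by simp
  qed
  \<comment> \<open>The level 8 suits the tail because \<open>exp 2 \<le> 8\<close>: as
    \<open>9 * V \<le> real K\<close> and \<open>\<sigma> \<le> 2\<close>, the factor
    \<open>exp (9 * (\<sigma> * V))\<close> that separates \<open>exp (8 * (\<sigma> * V))\<close>
    from \<open>exp (- \<sigma> * V)\<close> is at most \<open>8 ^ K\<close>.\<close>
  have "trunc_sum K (\<lambda>q. - b q) P \<le> (\<Prod>q\<in>P. 1 - b q) + (\<Prod>q\<in>P. 1 + 8 * \<bar>b q\<bar>) / 8 ^ K"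
    using trunc_sum_tail[OF fin, of 8 K "\<lambda>q. - b q"] by (simp add: abs_le_iff)
  also have "(\<Prod>q\<in>P. 1 - b q) \<le> (\<Prod>q\<in>P. exp (- b q))"
    using b01 by (intro prod_mono) (auto intro: exp_ge_add_one_self[of "- _", simplified])
  also have "\<dots> = exp (- \<sigma> * V)" using fin by (simp add: exp_sum[symmetric] sum_negf sumb)
  also have "(\<Prod>q\<in>P. 1 + 8 * \<bar>b q\<bar>) / 8 ^ K \<le> exp (- \<sigma> * V)"
  proof -
    have "(\<Prod>q\<in>P. 1 + 8 * \<bar>b q\<bar>) \<le> exp (\<Sum>q\<in>P. 8 * \<bar>b q\<bar>)" by (rule prod_le_exp_sum) auto
    also have "(\<Sum>q\<in>P. 8 * \<bar>b q\<bar>) = 8 * (\<sigma> * V)" using b01 by (simp add: sumb[symmetric] sum_distrib_left)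
    also have "exp (8 * (\<sigma> * V)) = exp (- \<sigma> * V) * exp (9 * (\<sigma> * V))" by (simp flip: exp_add)
    also have "exp (9 * (\<sigma> * V)) \<le> exp (real K * 2)" using \<sigma>V K9 by simp
    also have "\<dots> = exp 2 ^ K" by (rule exp_of_nat_mult)
    also have "\<dots> \<le> 8 ^ K" using e8 by (intro power_mono) auto
    finally show ?thesis by (simp add: divide_le_eq)
  qed
  finally have 2: "trunc_sum K (\<lambda>q. - b q) P \<le> 2 * exp (- \<sigma> * V)" by simp
  have cardP: "card P \<le> z"
  proof -
    have "P \<subseteq> {1..z}"
    proof
      fix q assume "q \<in> P"
      then show "q \<in> {1..z}" using q2[of q] P(1) by (simp add: subset_iff)
    qed
    then show ?thesis using card_mono[of "{1..z}" P] by simp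
  qed
  \<comment> \<open>With \<open>u = z\<close>, the at most \<open>z\<close> primes contribute a
    bounded product, so the remainder is at most \<open>8 * z ^ K\<close>.\<close>
  have "(\<Sum>q\<in>P. \<sigma> / real z) \<le> 2"
  proof -
    have "real (card P) * \<sigma> \<le> real z * 2" using cardP \<sigma> by (intro mult_mono) auto
    then show ?thesis using z by (simp add: field_simps)
  qed
  then have "exp (\<Sum>q\<in>P. \<sigma> / real z) \<le> exp 2" by simp
  moreover have "(\<Prod>q\<in>P. 1 + \<sigma> / real z) \<le> exp (\<Sum>q\<in>P. \<sigma> / real z)"
    using \<sigma> by (intro prod_le_exp_sum) auto
  ultimately have "(\<Prod>q\<in>P. 1 + \<sigma> / real z) \<le> 8" using e8 by linarith
  then have "real z ^ K * (\<Prod>q\<in>P. 1 + \<sigma> / real z) \<le> real z ^ K * 8"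
    by (intro mult_left_mono) auto
  moreover have "trunc_sum K (\<lambda>_. \<sigma>) P \<le> real z ^ K * (\<Prod>q\<in>P. 1 + \<sigma> / real z)"
    using \<sigma> z by (intro trunc_sum_le fin) auto
  ultimately have "trunc_sum K (\<lambda>_. \<sigma>) P \<le> real z ^ K * 8" by linarith
  also have "real z ^ K * 8 \<le> (real N * exp (- \<sigma> * V)) * 8"
  proof -
    \<comment> \<open>The remainder must be small relative to \<open>N\<close> by the same
      exponential factor. Half of \<open>z ^ (2 * K)\<close> pays for it, since
      \<open>exp (\<sigma> * V) \<le> 2 ^ K \<le> z ^ K\<close>.\<close>
    have "exp (\<sigma> * V) \<le> exp (real K * ln 2)"
    proof -
      have "\<sigma> * V \<le> real K * (2/9)" using \<sigma>V K9 by simp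
      also have "\<dots> \<le> real K * ln 2" using ln2_ge_two_thirds by (intro mult_left_mono) auto
      finally show ?thesis by simp
    qed
    also have "\<dots> = 2 ^ K" by (simp add: exp_of_nat_mult)
    also have "\<dots> \<le> real z ^ K" using z by (intro power_mono) auto
    finally have "real z ^ K * exp (\<sigma> * V) \<le> real z ^ K * real z ^ K" by (intro mult_left_mono) auto
    also have "\<dots> = real (z ^ (2 * K))" by (simp add: power_add mult_2)
    also have "\<dots> \<le> real N" using z by linarith
    finally show ?thesis by (simp add: exp_minus field_simps)
  qed
  finally have 3: "trunc_sum K (\<lambda>_. \<sigma>) P \<le> 8 * (real N * exp (- \<sigma> * V))" by (simp add: mult.commute)
  have "real N * trunc_sum K (\<lambda>q. - b q) P \<le> real N * (2 * exp (- \<sigma> * V))"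
    using 2 by (intro mult_left_mono) auto
  with 1 3 show ?thesis by (simp add: a_def V_def \<sigma>_def algebra_simps)
qed

subsection \<open>Sieving primes\<close>

lemma harm_power2_le: "(harm (2 ^ m) :: real) \<le> 1 + real m"
proof (induction m)
  case (Suc m)
  have "(harm (2 ^ Suc m) :: real) = harm (2 ^ m) + (\<Sum>k\<in>{2 ^ m<..2 ^ Suc m}. inverse (real k))"
    unfolding harm_def by (subst sum.union_disjoint[symmetric]) (auto intro!: sum.cong)
  also have "(\<Sum>k\<in>{2 ^ m<..2 ^ Suc m::nat}. inverse (real k)) \<le> (\<Sum>k\<in>{2 ^ m<..2 ^ Suc m::nat}. inverse (2 ^ m))"
    by (intro sum_mono le_imp_inverse_le) (auto simp flip: of_nat_power simp: of_nat_le_iff)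
  also have "\<dots> = 1" by simp
  finally show ?case using Suc by simp
qed (simp add: harm_def)

lemma sum_inverse_squares_le: "(\<Sum>k=1..m. 1 / real k ^ 2) \<le> 2"
proof -
  have "(\<Sum>k=1..Suc m. 1 / real k ^ 2) \<le> 2 - 1 / real (Suc m)" for m
  proof (induction m)
    case (Suc m)
    have "1 / real (Suc (Suc m)) ^ 2 \<le> 1 / real (Suc m) - 1 / real (Suc (Suc m))"
    proof -
      have "1 / real (Suc (Suc m)) ^ 2 \<le> 1 / (real (Suc m) * real (Suc (Suc m)))"
        unfolding power2_eq_square by (intro divide_left_mono mult_right_mono) auto
      also have "\<dots> = 1 / real (Suc m) - 1 / real (Suc (Suc m))" by (simp add: divide_simps)
      finally show ?thesis .
    qed
    then show ?case using Suc by simp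
  qed simp
  note * = this
  show ?thesis
  proof (cases m)
    case (Suc k)
    have "0 \<le> 1 / real (Suc k)" by simp
    then show ?thesis unfolding Suc using *[of k] by linarith
  qed simp
qed

text \<open>Each \<open>n\<close> up to \<open>z\<close> is uniquely a squarefree number times a
  square. Hence the harmonic sum, which is at least \<open>ln (real z + 1)\<close>, is at most the
  product of \<open>1 + 1 / q\<close> times the sum of inverse squares, so at most
  \<open>2 * exp V\<close>; then take logarithms.\<close>

lemma sum_inverse_primes_ge:
  assumes "1 \<le> z"
  shows "ln (ln (real z + 1)) - ln 2 \<le> (\<Sum>q | Factorial_Ring.prime q \<and> q \<le> z. 1 / real q)"
proof -
  define P where "P = {q::nat. Factorial_Ring.prime q \<and> q \<le> z}"
  define V where "V = (\<Sum>q\<in>P. 1 / real q)"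
  have fin: "finite P" by (simp add: P_def)
  define h where "h n = (prime_factors (squarefree_part n), square_part n)" for n :: nat
  define G where "G = (\<lambda>(D, k). (\<Prod>q\<in>D. 1 / real q) * (1 / real k ^ 2))"
  have sq: "squarefree_part n = \<Prod>(prime_factors (squarefree_part n))" for n :: nat
  proof -
    have "squarefree_part n = (\<Prod>p\<in>prime_factors (squarefree_part n). p ^ multiplicity p (squarefree_part n))"
      by (rule prime_factorization_nat) (use squarefree_part_nonzero[of n] in \<open>simp only: neq0_conv\<close>)
    also have "\<dots> = (\<Prod>p\<in>prime_factors (squarefree_part n). p)"
    proof (intro prod.cong refl)
      fix p assume "p \<in> prime_factors (squarefree_part n)"
      then have "Factorial_Ring.prime p" "0 < multiplicity p (squarefree_part n)"
        by (auto simp: prime_factors_multiplicity)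
      then show "p ^ multiplicity p (squarefree_part n) = p"
        using prime_multiplicity_squarefree_part_le_Suc_0[of p n] by (simp add: le_Suc_eq)
    qed
    finally show ?thesis by simp
  qed
  have dec: "n = \<Prod>(fst (h n)) * (snd (h n))\<^sup>2" for n
    unfolding h_def fst_conv snd_conv sq[of n, symmetric] by (rule squarefree_decompose)
  have inj: "inj_on h {1..z}" by (metis dec inj_onI)
  have sub: "h ` {1..z} \<subseteq> Pow P \<times> {1..z}"
  proof clarify
    fix n D k assume n: "n \<in> {1..z}" "(D, k) = h n"
    have "squarefree_part n dvd n" "(square_part n)\<^sup>2 dvd n" by (subst (2) squarefree_decompose[of n], rule dvd_triv_left, rule square_part_square_dvd)
    then have *: "squarefree_part n \<le> z" "(square_part n)\<^sup>2 \<le> z" using dvd_imp_le[of _ n] n by fastforce+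
    have "D \<subseteq> P"
    proof
      fix p assume "p \<in> D"
      then have "Factorial_Ring.prime p" "p dvd squarefree_part n" using n by (auto simp: h_def)
      then have "p \<le> squarefree_part n" using squarefree_part_nonzero[of n]
        by (intro dvd_imp_le) (auto simp del: squarefree_part_nonzero)
      then show "p \<in> P" using * \<open>Factorial_Ring.prime p\<close> by (simp add: P_def)
    qed
    moreover have "k \<noteq> 0" using n by (auto simp: h_def)
    moreover have "k \<le> z" using n * by (auto simp: h_def power2_eq_square intro: order.trans[OF le_square])
    ultimately show "D \<in> Pow P \<and> k \<in> {1..z}" by auto
  qed
  have "ln (real z + 1) \<le> (\<Sum>n\<in>{1..z}. 1 / real n)"
    using ln_le_harm[of z] by (simp add: harm_def divide_inverse)
  also have "\<dots> = (\<Sum>n\<in>{1..z}. G (h n))"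
  proof (intro sum.cong refl)
    fix n
    have "real n = real (\<Prod>(fst (h n)) * (snd (h n))\<^sup>2)" by (rule arg_cong[OF dec])
    also have "\<dots> = (\<Prod>q\<in>fst (h n). real q) * real (snd (h n)) ^ 2" by simp
    finally have *: "real n = (\<Prod>q\<in>fst (h n). real q) * real (snd (h n)) ^ 2" .
    show "1 / real n = G (h n)" unfolding * by (simp add: G_def case_prod_unfold prod_dividef)
  qed
  also have "\<dots> = (\<Sum>x\<in>h ` {1..z}. G x)" using inj by (simp add: sum.reindex)
  also have "\<dots> \<le> (\<Sum>x\<in>Pow P \<times> {1..z}. G x)"
    using sub fin by (intro sum_mono2) (auto simp: G_def intro!: divide_nonneg_nonneg prod_nonneg)
  also have "\<dots> = (\<Sum>D\<in>Pow P. \<Prod>q\<in>D. 1 / real q) * (\<Sum>k=1..z. 1 / real k ^ 2)"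
    by (simp add: G_def sum.cartesian_product[symmetric] sum_product)
  also have "(\<Sum>D\<in>Pow P. \<Prod>q\<in>D. 1 / real q) = (\<Prod>q\<in>P. 1 / real q + 1)"
    using prod_add[OF fin, of "\<lambda>q. 1 / real q" "\<lambda>_. 1"] by simp
  also have "\<dots> * (\<Sum>k=1..z. 1 / real k ^ 2) \<le> exp V * 2"
    unfolding V_def using prod_le_exp_sum[of P "\<lambda>q. 1 / real q"] sum_inverse_squares_le[of z]
    by (intro mult_mono) (auto simp: add.commute sum_nonneg)
  finally have *: "ln (real z + 1) \<le> 2 * exp V" by simp
  have "0 < ln (real z + 1)" using assms by simp
  then have "ln (ln (real z + 1)) \<le> ln (2 * exp V)" using * by (subst ln_le_cancel_iff) auto
  also have "\<dots> = ln 2 + V" by (simp add: ln_mult)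
  finally show ?thesis by (simp add: V_def P_def)
qed

text \<open>Passing to a subset of the primes up to \<open>z\<close> gives an upper bound on the sum of the reciprocals
  for free, so that no upper bound of Chebyshev or Mertens type is needed.\<close>

lemma greedy_subset_sum:
  fixes g :: "'a \<Rightarrow> real"
  assumes "finite A" "\<And>a. a \<in> A \<Longrightarrow> g a \<le> 1" "0 \<le> L" "L \<le> sum g A"
  shows "\<exists>P\<subseteq>A. L \<le> sum g P \<and> sum g P \<le> L + 1"
  using assms(1,2,4)
proof (induction A rule: finite_induct)
  case (insert a A)
  show ?case
  proof (cases "L \<le> sum g A")
    case True
    then show ?thesis using insert by (meson insertI2 subset_insertI2)
  next
    case False
    then show ?thesis using insert.hyps insert.prems
      by (intro exI[of _ "insert a A"]) (auto simp: add.commute intro: add_mono)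
  qed
qed (use assms(3) in auto)

text \<open>The lower bound is what the sieve saves in its exponent; the upper bound allows a cutoff
  \<open>K\<close> linear in \<open>e\<close>.\<close>

lemma obtain_sieving_primes:
  fixes e :: nat
  assumes "2 \<le> e"
  obtains P where "P \<subseteq> {..2 ^ 2 ^ e}" "\<And>q. q \<in> P \<Longrightarrow> Factorial_Ring.prime (q :: nat)"
    "real e * ln 2 - 2 \<le> (\<Sum>q\<in>P. 1 / real q)" "(\<Sum>q\<in>P. 1 / real q) \<le> real e"
proof -
  define A where "A = {q::nat. Factorial_Ring.prime q \<and> q \<le> 2 ^ 2 ^ e}"
  \<comment> \<open>The greedy choice needs a nonnegative target, and
    \<open>real e * ln 2 - 2\<close> is negative at \<open>e = 2\<close>.\<close>
  define L where "L = max 0 (real e * ln 2 - 2)"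
  have "real e * ln 2 - 2 \<le> ln (ln (real (2 ^ 2 ^ e) + 1)) - ln 2"
  proof -
    have "ln (2 ^ e * ln 2) = ln (ln (real (2 ^ 2 ^ e)))" by (simp add: ln_realpow)
    also have "\<dots> \<le> ln (ln (real (2 ^ 2 ^ e) + 1))"
    proof -
      have "0 < ln (real (2 ^ 2 ^ e))" "ln (real (2 ^ 2 ^ e)) \<le> ln (real (2 ^ 2 ^ e) + 1)"
        by (auto intro!: ln_gt_zero ln_mono)
      then show ?thesis by (intro ln_mono) auto
    qed
    finally have 1: "real e * ln 2 + ln (ln 2) \<le> ln (ln (real (2 ^ 2 ^ e) + 1))"
      by (simp add: ln_mult ln_realpow)
    \<comment> \<open>The constant 2 covers two losses of at most \<open>ln 2\<close> each: the one
      from the reciprocal sum over primes, and \<open>- ln (ln 2)\<close>.\<close>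
    have "(1/2::real) \<le> ln 2" using ln2_ge_two_thirds by simp
    then have "ln (1/2) \<le> ln (ln 2 :: real)" by (subst ln_le_cancel_iff) auto
    then have 2: "- ln 2 \<le> ln (ln 2 :: real)" by (simp add: ln_div)
    have "ln 2 \<le> (1::real)" using ln_le_minus_one[of 2] by simp
    then show ?thesis using 1 2 by linarith
  qed
  also have "\<dots> \<le> (\<Sum>q\<in>A. 1 / real q)" unfolding A_def by (rule sum_inverse_primes_ge) simp
  finally have "L \<le> (\<Sum>q\<in>A. 1 / real q)" by (simp add: L_def sum_nonneg)
  moreover have "finite A" by (simp add: A_def)
  moreover have "1 / real q \<le> 1" if "q \<in> A" for q using that prime_ge_1_nat[of q] by (auto simp: A_def)
  ultimately obtain P where P: "P \<subseteq> A" "L \<le> (\<Sum>q\<in>P. 1 / real q)" "(\<Sum>q\<in>P. 1 / real q) \<le> L + 1"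
    using greedy_subset_sum[of A "\<lambda>q. 1 / real q" L] by (auto simp: L_def)
  have "ln 2 \<le> (1::real)" using ln_le_minus_one[of 2] by simp
  then have *: "real e * ln 2 \<le> real e" by (simp add: mult_left_le)
  have "L \<le> real e - 1" unfolding L_def by (rule max.boundedI) (use * assms in linarith)+
  then have "L + 1 \<le> real e" by simp
  then show ?thesis using P by (intro that[of P]) (auto simp: A_def L_def)
qed

subsection \<open>Multiples of shifted primes\<close>

lemma sum_multiples:
  fixes f :: "nat \<Rightarrow> real"
  assumes "0 < r"
  shows "(\<Sum>d=1..x. of_bool (r dvd d) * f d) = (\<Sum>d=1..x div r. f (r * d))"
proof -
  have "{d \<in> {1..x}. r dvd d} = (*) r ` {1..x div r}"
  proof (intro equalityI subsetI)
    fix d assume "d \<in> {d \<in> {1..x}. r dvd d}"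
    then obtain k where "d = r * k" "1 \<le> r * k" "r * k \<le> x" by auto
    moreover from this have "1 \<le> k" "k \<le> x div r"
      using assms by (auto simp: less_eq_div_iff_mult_less_eq mult.commute Suc_le_eq)
    ultimately show "d \<in> (*) r ` {1..x div r}" by auto
  next
    fix d assume "d \<in> (*) r ` {1..x div r}"
    then show "d \<in> {d \<in> {1..x}. r dvd d}"
      using assms by (auto simp: less_eq_div_iff_mult_less_eq mult.commute Suc_le_eq)
  qed
  moreover have "inj_on ((*) r) {1..x div r}" using assms by (auto simp: inj_on_def)
  ultimately have "(\<Sum>d | d \<in> {1..x} \<and> r dvd d. f d) = (\<Sum>d=1..x div r. f (r * d))"
    by (simp add: sum.reindex)
  moreover have "(\<Sum>d | d \<in> {1..x} \<and> r dvd d. f d) = (\<Sum>d=1..x. if r dvd d then f d else 0)"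
    by (rule sum.inter_filter) simp
  moreover have "(\<Sum>d=1..x. if r dvd d then f d else 0) = (\<Sum>d=1..x. of_bool (r dvd d) * f d)"
    by (intro sum.cong) auto
  ultimately show ?thesis by simp
qed

text \<open>Counting squares as well makes the count of \<open>n * m\<close> at least the sum of the numbers of primes in \<open>P\<close>
  dividing \<open>n\<close> and \<open>m\<close>.\<close>

definition prime_count2 :: "nat set \<Rightarrow> nat \<Rightarrow> nat" where
  "prime_count2 P d = (\<Sum>q\<in>P. of_bool (q dvd d) + of_bool (q ^ 2 dvd d))"

text \<open>A new prime \<open>q\<close> adds to the weight \<open>s - 1\<close> times its
  restriction to multiples of \<open>q\<close> and \<open>s\<^sup>2 - s\<close> times that to
  multiples of \<open>q ^ 2\<close>, both coefficients being nonnegative. On multiples of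
  \<open>q ^ j\<close> one divides out \<open>q ^ j\<close>, which leaves the count over the other
  primes unchanged, and uses induction up to \<open>x div q ^ j\<close>.\<close>

lemma sum_power_prime_count2_le:
  fixes s :: real
  assumes "finite P" "\<And>q. q \<in> P \<Longrightarrow> Factorial_Ring.prime (q :: nat)" "1 \<le> s"
  shows "(\<Sum>d=1..x. s ^ prime_count2 P d) \<le> real x * (\<Prod>q\<in>P. 1 + ((s - 1) / real q + (s\<^sup>2 - s) / real q ^ 2))"
  using assms(1,2)
proof (induction P arbitrary: x rule: finite_induct)
  case empty
  then show ?case by (simp add: prime_count2_def)
next
  case (insert q P)
  let ?C = "\<Prod>q\<in>P. 1 + ((s - 1) / real q + (s\<^sup>2 - s) / real q ^ 2)"
  let ?g = "\<lambda>d. s ^ prime_count2 P d"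
  have q: "Factorial_Ring.prime q" "0 < q" using insert.prems prime_gt_0_nat by auto
  have s2: "0 \<le> s\<^sup>2 - s" using assms(3) self_le_power[of s 2] by simp
  have C0: "0 \<le> ?C" using s2 assms(3) by (intro prod_nonneg) auto
  have inv: "prime_count2 P (q ^ j * d) = prime_count2 P d" for j d
  proof -
    have "coprime r (q ^ j)" "coprime (r ^ 2) (q ^ j)" if "r \<in> P" for r
      using that insert.hyps insert.prems q primes_coprime[of r q] by (auto simp: coprime_power_right_iff)
    then show ?thesis unfolding prime_count2_def
      by (intro sum.cong refl) (simp add: coprime_dvd_mult_right_iff)
  qed
  have shift: "(\<Sum>d=1..x. of_bool (q ^ j dvd d) * ?g d) \<le> real x / real q ^ j * ?C" for j
  proof -
    have "(\<Sum>d=1..x. of_bool (q ^ j dvd d) * ?g d) = (\<Sum>d=1..x div q ^ j. ?g d)"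
      using sum_multiples[of "q ^ j" ?g x] q by (simp add: inv)
    also have "\<dots> \<le> real (x div q ^ j) * ?C" using insert by blast
    also have "\<dots> \<le> real x / real q ^ j * ?C"
      using of_nat_div_le_of_nat[where 'a=real, of x "q ^ j"] C0 by (intro mult_right_mono) auto
    finally show ?thesis .
  qed
  have "s ^ prime_count2 (insert q P) d = ?g d + (s - 1) * (of_bool (q dvd d) * ?g d) + (s\<^sup>2 - s) * (of_bool (q ^ 2 dvd d) * ?g d)" for d
  proof -
    have "q dvd d" if "q\<^sup>2 dvd d" using that by (metis dvd_mult_left power2_eq_square)
    moreover have "prime_count2 (insert q P) d = of_bool (q dvd d) + of_bool (q ^ 2 dvd d) + prime_count2 P d"
      using insert.hyps by (simp add: prime_count2_def)
    ultimately show ?thesis by (auto simp: power2_eq_square algebra_simps)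
  qed
  then have "(\<Sum>d=1..x. s ^ prime_count2 (insert q P) d)
      = (\<Sum>d=1..x. of_bool (q ^ 0 dvd d) * ?g d) + (s - 1) * (\<Sum>d=1..x. of_bool (q ^ 1 dvd d) * ?g d)
        + (s\<^sup>2 - s) * (\<Sum>d=1..x. of_bool (q ^ 2 dvd d) * ?g d)"
    by (simp only: sum.distrib sum_distrib_left power_0 power_one_right one_dvd of_bool_eq mult_1)
  also have "\<dots> \<le> real x / real q ^ 0 * ?C + (s - 1) * (real x / real q ^ 1 * ?C)
        + (s\<^sup>2 - s) * (real x / real q ^ 2 * ?C)"
    using shift s2 assms(3) by (intro add_mono mult_left_mono) (blast | simp)+
  also have "\<dots> = real x * ((1 + ((s - 1) / real q + (s\<^sup>2 - s) / real q ^ 2)) * ?C)"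
    using q by (simp add: field_simps)
  finally show ?case using insert.hyps by simp
qed

text \<open>These bounds fix the rates of decay: the first gives 1/3 - (3/2)(2/7) = -2/21 in the
  Rankin bound, the second (3/2)(7/24) - 1/4 - 5/4 = -17/16 in the sieve bound. What matters is that
  the former is negative and the latter below -1.\<close>

lemma ln_four_thirds: "2 / 7 \<le> ln (4 / 3 :: real)" "ln (4 / 3 :: real) \<le> 7 / 24"
proof -
  have "exp 2 = exp 1 * (exp 1 :: real)" by (simp flip: exp_add)
  also have "\<dots> \<le> 272/100 * (272/100)" using e_less_272 by (intro mult_mono) auto
  also have "\<dots> \<le> (4/3) ^ 7" by (simp add: power_numeral_reduce)
  finally have "ln (exp 2) \<le> ln ((4/3) ^ 7 :: real)" by (intro ln_mono) auto
  then show "2 / 7 \<le> ln (4 / 3 :: real)" by (simp add: ln_realpow)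
  have e: "27/10 \<le> exp (1::real)" 
  proof -
    have "\<bar>exp 1 - 5837465777 / 2147483648\<bar> \<le> (1 / 1000 :: real)"
      using e_approx_32 by (rule order.trans) simp
    then show ?thesis unfolding abs_le_iff by linarith
  qed
  have "(4/3) ^ 24 \<le> (27/10 :: real) ^ 7" by (simp add: power_numeral_reduce)
  also have "\<dots> \<le> exp 1 ^ 7" using e by (intro power_mono) auto
  also have "\<dots> = exp 7" by (simp flip: exp_of_nat_mult)
  finally have "ln ((4/3) ^ 24 :: real) \<le> ln (exp 7)" by (intro ln_mono) auto
  then show "ln (4 / 3 :: real) \<le> 7 / 24" by (simp add: ln_realpow)
qed

lemma exp_1_le_3: "exp 1 \<le> (3 :: real)"
  using e_less_272 by simp

text \<open>Markov's inequality for the weight with base 4/3: it exceeds (4/3)^(3/2 V) on the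
  counted \<open>d\<close>, while its mean is at most \<open>3 * exp (1/3 * V)\<close>.\<close>

lemma card_prime_count2_gt_le:
  assumes "finite P" "\<And>q. q \<in> P \<Longrightarrow> Factorial_Ring.prime (q :: nat)"
  defines "V \<equiv> (\<Sum>q\<in>P. 1 / real q)"
  shows "real (card {d \<in> {1..x}. 3 / 2 * V < real (prime_count2 P d)}) \<le> 3 * real x * exp (- 2 / 21 * V)"
proof -
  define l where "l = ln (4 / 3 :: real)"
  have l: "2/7 \<le> l" "exp l = 4/3" using ln_four_thirds by (auto simp: l_def)
  have V0: "0 \<le> V" by (simp add: V_def sum_nonneg)
  let ?S = "{d \<in> {1..x}. 3 / 2 * V < real (prime_count2 P d)}"
  have "real (card ?S) * exp (3/2 * V * l) = (\<Sum>d\<in>?S. exp (3/2 * V * l))" by simp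
  also have "\<dots> \<le> (\<Sum>d\<in>?S. (4/3) ^ prime_count2 P d)"
  proof (rule sum_mono)
    fix d assume "d \<in> ?S"
    then have "3/2 * V * l \<le> real (prime_count2 P d) * l" using l by (intro mult_right_mono) auto
    then have "exp (3/2 * V * l) \<le> exp (real (prime_count2 P d) * l)" by simp
    then show "exp (3/2 * V * l) \<le> (4/3) ^ prime_count2 P d" by (simp add: exp_of_nat_mult l)
  qed
  also have "\<dots> \<le> (\<Sum>d=1..x. (4/3) ^ prime_count2 P d)" by (intro sum_mono2) auto
  also have "\<dots> \<le> real x * (\<Prod>q\<in>P. 1 + ((4/3 - 1) / real q + ((4/3)\<^sup>2 - 4/3) / real q ^ 2))"
    using assms by (intro sum_power_prime_count2_le) auto
  also have "\<dots> \<le> real x * (exp (1/3 * V) * 3)"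
  proof (intro mult_left_mono)
    \<comment> \<open>The squares of primes add at most (4/9) * 2 < 1 to the exponent, whence the
      constant 3.\<close>
    have sq: "(\<Sum>q\<in>P. 1 / real q ^ 2) \<le> 2"
    proof -
      have "q \<in> {1..Max (insert 1 P)}" if "q \<in> P" for q
        using that assms(1,2) prime_ge_1_nat by auto
      then have "(\<Sum>q\<in>P. 1 / real q ^ 2) \<le> (\<Sum>q=1..Max (insert 1 P). 1 / real q ^ 2)"
        by (intro sum_mono2) auto
      then show ?thesis using sum_inverse_squares_le[of "Max (insert 1 P)"] by linarith
    qed
    have "(\<Prod>q\<in>P. 1 + ((4/3 - 1) / real q + ((4/3)\<^sup>2 - 4/3) / real q ^ 2))
      \<le> exp (\<Sum>q\<in>P. (4/3 - 1) / real q + ((4/3)\<^sup>2 - 4/3) / real q ^ 2)"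
      by (intro prod_le_exp_sum) (auto simp: power2_eq_square)
    also have "(\<Sum>q\<in>P. (4/3 - 1) / real q + ((4/3)\<^sup>2 - 4/3) / real q ^ 2) = 1/3 * V + 4/9 * (\<Sum>q\<in>P. 1 / real q ^ 2)"
      by (simp add: sum.distrib V_def sum_distrib_left power2_eq_square)
    also have "exp \<dots> \<le> exp (1/3 * V + 1)" using sq by simp
    also have "\<dots> = exp (1/3 * V) * exp 1" by (rule exp_add)
    also have "\<dots> \<le> exp (1/3 * V) * 3" using exp_1_le_3 by (intro mult_left_mono) auto
    finally show "(\<Prod>q\<in>P. 1 + ((4/3 - 1) / real q + ((4/3)\<^sup>2 - 4/3) / real q ^ 2)) \<le> exp (1/3 * V) * 3" .
  qed auto
  finally have "real (card ?S) \<le> 3 * real x * (exp (1/3 * V) / exp (3/2 * V * l))"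
    by (simp add: field_simps)
  also have "exp (1/3 * V) / exp (3/2 * V * l) = exp (1/3 * V - 3/2 * V * l)" by (simp add: exp_diff)
  also have "\<dots> \<le> exp (- 2 / 21 * V)"
    using mult_left_mono[OF l(1) V0] by simp
  finally show ?thesis by (simp add: mult_left_mono)
qed

section \<open>Sieve bounds for a shifted prime times a cofactor\<close>

text \<open>A prime \<open>n + 1\<close> above \<open>z\<close> is divisible by no \<open>q\<close>
  in \<open>P\<close>, so the sieve weight with \<open>\<alpha> = 1\<close> agrees with the summand.
  Nonnegativity then permits extending the sum to all \<open>n\<close> up to
  \<open>N\<close>.\<close>

lemma sum_shifted_primes_le:
  fixes \<beta> :: real and z N K :: nat
  assumes P: "P \<subseteq> {..z}" "\<And>q. q \<in> P \<Longrightarrow> Factorial_Ring.prime q"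
    and \<beta>: "0 \<le> \<beta>" "\<beta> \<le> 1"
    and K: "even K" "9 * (\<Sum>q\<in>P. 1 / real q) \<le> real K" and z: "2 \<le> z" "z ^ (2 * K) \<le> N"
  shows "(\<Sum>n | n \<in> {z..N} \<and> Factorial_Ring.prime (n + 1). \<Prod>q\<in>P. 1 - \<beta> * of_bool (q dvd n))
          \<le> 10 * real N * exp (- (1 + \<beta>) * (\<Sum>q\<in>P. 1 / real q))"
proof -
  let ?f = "\<lambda>n. \<Prod>q\<in>P. 1 - (1 * of_bool (q dvd n + 1) + \<beta> * of_bool (q dvd n))"
  have nn: "0 \<le> ?f n" for n
  proof (rule prod_nonneg)
    fix q assume "q \<in> P"
    then have "\<not> (q dvd n + 1 \<and> q dvd n)"
      using P(2) by (metis dvd_add_right_iff not_prime_1 nat_dvd_1_iff_1)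
    then show "0 \<le> 1 - (1 * of_bool (q dvd n + 1) + \<beta> * of_bool (q dvd n))" using \<beta> by auto
  qed
  have "(\<Sum>n | n \<in> {z..N} \<and> Factorial_Ring.prime (n + 1). \<Prod>q\<in>P. 1 - \<beta> * of_bool (q dvd n))
      = (\<Sum>n | n \<in> {z..N} \<and> Factorial_Ring.prime (n + 1). ?f n)"
  proof (intro sum.cong prod.cong refl)
    fix n q assume n: "n \<in> {n. n \<in> {z..N} \<and> Factorial_Ring.prime (n + 1)}" and q: "q \<in> P"
    have "\<not> q dvd n + 1"
    proof
      assume "q dvd n + 1"
      then have "q = n + 1" using n P(2)[OF q] primes_dvd_imp_eq by blast
      then show False using n P(1) q by auto
    qed
    then show "1 - \<beta> * of_bool (q dvd n) = 1 - (1 * of_bool (q dvd n + 1) + \<beta> * of_bool (q dvd n))" by simp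
  qed
  also have "\<dots> \<le> (\<Sum>n=1..N. ?f n)" using nn z by (intro sum_mono2) auto
  also have "\<dots> \<le> 10 * real N * exp (- (1 + \<beta>) * (\<Sum>q\<in>P. 1 / real q))"
    using brun_sieve[OF P, of 1 \<beta> K N] \<beta> K z by simp
  finally show ?thesis .
qed

lemma sum_UN_le:
  fixes f :: "'a \<Rightarrow> real"
  assumes "finite I" "\<And>i. i \<in> I \<Longrightarrow> finite (D i)" "\<And>x. 0 \<le> f x"
  shows "sum f (\<Union>i\<in>I. D i) \<le> (\<Sum>i\<in>I. sum f (D i))"
  using assms(1,2)
proof (induction I rule: finite_induct)
  case (insert i I)
  have "sum f (D i \<union> (\<Union>i\<in>I. D i)) = sum f (D i) + sum f (\<Union>i\<in>I. D i) - sum f (D i \<inter> (\<Union>i\<in>I. D i))"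
    using insert by (intro sum_Un) auto
  moreover have "0 \<le> sum f (D i \<inter> (\<Union>i\<in>I. D i))" using assms(3) by (intro sum_nonneg) auto
  moreover have "sum f (\<Union>i\<in>I. D i) \<le> (\<Sum>i\<in>I. sum f (D i))" using insert by auto
  ultimately show ?case using insert.hyps by simp
qed simp

text \<open>For fixed \<open>m\<close> the sieve with \<open>\<beta> = 0\<close> bounds the primes
  \<open>n + 1\<close> with \<open>n \<le> x div m\<close>; summing \<open>1 / m\<close> costs only
  the factor \<open>1 + \<mu>\<close>.\<close>

lemma card_multiples_small_cofactor_le:
  fixes z K :: nat
  assumes P: "P \<subseteq> {..z}" "\<And>q. q \<in> P \<Longrightarrow> Factorial_Ring.prime q"
    and K: "even K" "9 * (\<Sum>q\<in>P. 1 / real q) \<le> real K" and z: "2 \<le> z" "z ^ (2 * K) \<le> y" "z \<le> y"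
  shows "real (card {d \<in> {1..x}. \<exists>n m. d = n * m \<and> Factorial_Ring.prime (n + 1) \<and> y \<le> n \<and> m \<le> 2 ^ \<mu>})
          \<le> 10 * real x * exp (- (\<Sum>q\<in>P. 1 / real q)) * (1 + real \<mu>)"
    (is "real (card ?S) \<le> _")
proof -
  let ?V = "\<Sum>q\<in>P. 1 / real q"
  let ?T = "\<lambda>m. {n. n \<in> {y..x div m} \<and> Factorial_Ring.prime (n + 1)}"
  \<comment> \<open>Either no \<open>n\<close> qualifies, or \<open>x div m\<close> is at least
    \<open>y\<close>, long enough for the sieve.\<close>
  have T: "real (card (?T m)) \<le> 10 * exp (- ?V) * real x * inverse (real m)" for m
  proof (cases "y \<le> x div m")
    case True
    have "real (card (?T m)) = (\<Sum>n\<in>?T m. 1)" by simp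
    also have "\<dots> \<le> (\<Sum>n | n \<in> {z..x div m} \<and> Factorial_Ring.prime (n + 1). 1)"
      using z by (intro sum_mono2) auto
    also have "\<dots> \<le> 10 * real (x div m) * exp (- ?V)"
      using sum_shifted_primes_le[OF P, of 0 K "x div m"] K z True by simp
    also have "\<dots> \<le> 10 * (real x / real m) * exp (- ?V)"
      using of_nat_div_le_of_nat[where 'a=real, of x m] by (intro mult_right_mono mult_left_mono) auto
    finally show ?thesis by (simp add: field_simps)
  qed simp
  have "?S \<subseteq> (\<lambda>(m, n). n * m) ` (SIGMA m:{1..2 ^ \<mu>}. ?T m)"
  proof
    fix d assume "d \<in> ?S"
    then obtain n m where d: "d = n * m" "Factorial_Ring.prime (n + 1)" "y \<le> n" "m \<le> 2 ^ \<mu>" "1 \<le> n * m" "n * m \<le> x"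
      by auto
    then have "1 \<le> m" by (cases m) auto
    then have "(m, n) \<in> (SIGMA m:{1..2 ^ \<mu>}. ?T m)" using d by (auto simp: less_eq_div_iff_mult_less_eq)
    then show "d \<in> (\<lambda>(m, n). n * m) ` (SIGMA m:{1..2 ^ \<mu>}. ?T m)"
      using d by (intro image_eqI[of _ _ "(m, n)"]) auto
  qed
  then have "card ?S \<le> card (SIGMA m:{1..2 ^ \<mu>}. ?T m)"
    by (intro surj_card_le) auto
  then have "real (card ?S) \<le> (\<Sum>m\<in>{1..2 ^ \<mu>}. real (card (?T m)))"
    by (subst (asm) card_SigmaI) (auto simp flip: of_nat_sum)
  also have "\<dots> \<le> (\<Sum>m\<in>{1..2 ^ \<mu>}. 10 * exp (- ?V) * real x * inverse (real m))"
    by (intro sum_mono T)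
  also have "\<dots> = 10 * exp (- ?V) * real x * harm (2 ^ \<mu>)" by (simp add: harm_def sum_distrib_left)
  also have "\<dots> \<le> 10 * exp (- ?V) * real x * (1 + real \<mu>)"
    using harm_power2_le by (intro mult_left_mono) auto
  finally show ?thesis by (simp add: mult_ac)
qed

lemma prime_count2_mult_ge:
  "(\<Sum>q\<in>P. of_bool (q dvd n) + of_bool (q dvd m)) \<le> prime_count2 P (n * m)"
  unfolding prime_count2_def
proof (rule sum_mono)
  fix q
  have "q ^ 2 dvd n * m" if "q dvd n" "q dvd m" using mult_dvd_mono[OF that] by (simp add: power2_eq_square)
  then show "of_bool (q dvd n) + of_bool (q dvd m) \<le> (of_bool (q dvd n * m) + of_bool (q\<^sup>2 dvd n * m) :: nat)"
    by auto
qed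

text \<open>The condition on \<open>prime_count2\<close> bounds the prime counts of \<open>n\<close>
  and \<open>m\<close> together by 3/2 V, so \<open>W n * W m\<close>, which charges 3/4 for each
  prime, is at least (3/4)^(3/2 V). After this the condition is dropped: the sum over
  \<open>m\<close> gains exp(-V/4) by the sieve with \<open>\<alpha> = 0\<close>, the one over
  primes \<open>n + 1\<close> gains exp(-5/4 V).\<close>

lemma card_multiples_large_cofactor_le:
  fixes z K :: nat
  assumes P: "P \<subseteq> {..z}" "\<And>q. q \<in> P \<Longrightarrow> Factorial_Ring.prime q"
    and K: "even K" "9 * (\<Sum>q\<in>P. 1 / real q) \<le> real K" and z: "2 \<le> z" "z ^ (2 * K) \<le> M"
    and a: "M \<le> 2 ^ a" "z \<le> 2 ^ a"
  defines "V \<equiv> (\<Sum>q\<in>P. 1 / real q)"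
  shows "real (card {d \<in> {1..x}. (\<exists>n m. d = n * m \<and> Factorial_Ring.prime (n + 1) \<and> 2 ^ a \<le> n \<and> n < 2 ^ b \<and> M \<le> m)
                       \<and> real (prime_count2 P d) \<le> 3 / 2 * V})
          \<le> 200 * real x * real b * exp (- 17 / 16 * V)"
    (is "real (card ?S) \<le> _")
proof -
  define W where "W n = (\<Prod>q\<in>P. 1 - 1/4 * of_bool (q dvd n) :: real)" for n
  define l where "l = ln (4 / 3 :: real)"
  have l: "0 \<le> l" "l \<le> 7/24" "exp (- l) = 3/4" using ln_four_thirds by (auto simp: l_def exp_minus)
  have fin: "finite P" using P(1) finite_subset by blast
  have V0: "0 \<le> V" by (simp add: V_def sum_nonneg)
  have W0: "0 \<le> W n" for n unfolding W_def by (intro prod_nonneg) auto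
  have W: "W n = exp (- l * (\<Sum>q\<in>P. of_bool (q dvd n)))" for n
  proof -
    have "W n = (\<Prod>q\<in>P. exp (- l * of_bool (q dvd n)))"
      unfolding W_def by (intro prod.cong refl) (auto simp: l)
    also have "\<dots> = exp (\<Sum>q\<in>P. - l * of_bool (q dvd n))" using fin by (simp add: exp_sum)
    finally show ?thesis by (simp add: sum_distrib_left)
  qed
  define N where "N = {n :: nat. n \<in> {2 ^ a..<2 ^ b} \<and> Factorial_Ring.prime (n + 1)}"
  have finN: "finite N" by (simp add: N_def)
  have n0: "0 < n" if "n \<in> N" for n
  proof -
    have "(1::nat) \<le> 2 ^ a" by simp
    also have "2 ^ a \<le> n" using that by (simp add: N_def)
    finally show ?thesis by simp
  qed
  define T where "T = (SIGMA n:N. {M..x div n})"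
  have finT: "finite T" using finN by (simp add: T_def)
  let ?T' = "{t \<in> T. real (prime_count2 P (fst t * snd t)) \<le> 3 / 2 * V}"
  have "?S \<subseteq> (\<lambda>(n, m). n * m) ` ?T'"
  proof
    fix d assume "d \<in> ?S"
    then obtain n m where d: "d = n * m" "Factorial_Ring.prime (n + 1)" "2 ^ a \<le> n" "n < 2 ^ b" "M \<le> m"
        "n * m \<le> x" "real (prime_count2 P d) \<le> 3 / 2 * V"
      by auto
    then have "n \<in> N" by (simp add: N_def)
    then have "(n, m) \<in> ?T'" using d n0[of n] by (auto simp: T_def less_eq_div_iff_mult_less_eq mult.commute)
    then show "d \<in> (\<lambda>(n, m). n * m) ` ?T'" using d by (intro image_eqI[of _ _ "(n, m)"]) auto
  qed
  then have "card ?S \<le> card ?T'" using finT by (intro surj_card_le) auto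
  then have "real (card ?S) \<le> (\<Sum>t\<in>?T'. 1)" by simp
  also have "\<dots> \<le> (\<Sum>t\<in>?T'. exp (3/2 * V * l) * (W (fst t) * W (snd t)))"
  proof (rule sum_mono)
    fix t assume t: "t \<in> ?T'"
    obtain n m where nm: "t = (n, m)" by force
    have "real (\<Sum>q\<in>P. of_bool (q dvd n) + of_bool (q dvd m)) \<le> 3 / 2 * V"
    proof -
      have "real (\<Sum>q\<in>P. of_bool (q dvd n) + of_bool (q dvd m)) \<le> real (prime_count2 P (n * m))"
        by (intro of_nat_mono prime_count2_mult_ge)
      also have "\<dots> \<le> 3 / 2 * V" using t nm by simp
      finally show ?thesis .
    qed
    then have "(\<Sum>q\<in>P. of_bool (q dvd n)) + (\<Sum>q\<in>P. of_bool (q dvd m)) \<le> 3 / 2 * V"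
      by (simp add: sum.distrib)
    from mult_right_mono[OF this l(1)]
    have "1 \<le> exp (3/2 * V * l + (- l * (\<Sum>q\<in>P. of_bool (q dvd n)) + - l * (\<Sum>q\<in>P. of_bool (q dvd m))))"
      by (simp add: algebra_simps)
    then show "1 \<le> exp (3/2 * V * l) * (W (fst t) * W (snd t))"
      unfolding W nm fst_conv snd_conv exp_add .
  qed
  also have "\<dots> \<le> (\<Sum>t\<in>T. exp (3/2 * V * l) * (W (fst t) * W (snd t)))"
    using finT W0 by (intro sum_mono2) auto
  also have "\<dots> = exp (3/2 * V * l) * (\<Sum>n\<in>N. W n * (\<Sum>m\<in>{M..x div n}. W m))"
    using finN by (simp add: T_def sum_distrib_left sum.Sigma case_prod_unfold)
  also have "\<dots> \<le> exp (3/2 * V * l) * (\<Sum>n\<in>N. W n * (10 * exp (- V / 4) * real x / real n))"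
  proof (intro mult_left_mono sum_mono W0)
    fix n
    show "(\<Sum>m\<in>{M..x div n}. W m) \<le> 10 * exp (- V / 4) * real x / real n"
    proof (cases "M \<le> x div n")
      case True
      have "1 \<le> z ^ (2 * K)" using z(1) by simp
      then have "1 \<le> M" using z(2) by linarith
      then have "(\<Sum>m\<in>{M..x div n}. W m) \<le> (\<Sum>m=1..x div n. W m)" using W0 by (intro sum_mono2) auto
      also have "\<dots> \<le> 10 * real (x div n) * exp (- V / 4)"
        using brun_sieve[OF P, of 0 "1/4" K "x div n"] K z True by (simp add: W_def V_def)
      also have "\<dots> \<le> 10 * (real x / real n) * exp (- V / 4)"
        using of_nat_div_le_of_nat[where 'a=real, of x n] by (intro mult_right_mono mult_left_mono) auto
      finally show ?thesis by (simp add: field_simps)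
    qed simp
  qed simp
  also have "\<dots> = 10 * real x * exp (3/2 * V * l - V / 4) * (\<Sum>n\<in>N. W n / real n)"
  proof -
    have e: "exp (3/2 * V * l - V / 4) = exp (3/2 * V * l) * exp (- V / 4)" by (simp flip: exp_add)
    show ?thesis unfolding e sum_distrib_left by (intro sum.cong refl) simp
  qed
  \<comment> \<open>On a dyadic block the factor \<open>1 / n\<close> cancels the length, so each of
    the at most \<open>b\<close> blocks contributes a bounded multiple of exp(-5/4 V).\<close>
  also have "(\<Sum>n\<in>N. W n / real n) \<le> real b * (20 * exp (- 5 / 4 * V))"
  proof -
    define D where "D k = {n :: nat. n \<in> {2 ^ k..<2 ^ Suc k} \<and> Factorial_Ring.prime (n + 1)}" for k :: nat
    have "N \<subseteq> (\<Union>k\<in>{a..<b}. D k)"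
    proof
      fix n assume n: "n \<in> N"
      obtain k where k: "2 ^ k \<le> n" "n < 2 ^ (k + 1)" using ex_power_ivl1[of 2 n] n0[OF n] by auto
      have "2 ^ a \<le> n" "n < 2 ^ b" using n by (auto simp: N_def)
      then have *: "2 ^ a < (2::nat) ^ (k + 1)" "2 ^ k < (2::nat) ^ b" using k by linarith+
      from *(1) have "a < k + 1" by (rule power_less_imp_less_exp[rotated]) simp
      moreover from *(2) have "k < b" by (rule power_less_imp_less_exp[rotated]) simp
      ultimately have "a < k + 1" "k < b" by blast+
      then show "n \<in> (\<Union>k\<in>{a..<b}. D k)" using k n by (auto simp: D_def N_def)
    qed
    then have "(\<Sum>n\<in>N. W n / real n) \<le> (\<Sum>n\<in>(\<Union>k\<in>{a..<b}. D k). W n / real n)"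
      using W0 by (intro sum_mono2) (auto simp: D_def)
    also have "\<dots> \<le> (\<Sum>k\<in>{a..<b}. \<Sum>n\<in>D k. W n / real n)"
      using W0 by (intro sum_UN_le) (auto simp: D_def)
    also have "\<dots> \<le> (\<Sum>k\<in>{a..<b}. 20 * exp (- 5 / 4 * V))"
    proof (rule sum_mono)
      fix k assume k: "k \<in> {a..<b}"
      have ak: "2 ^ a \<le> (2::nat) ^ k" using k by (intro power_increasing) auto
      have "(\<Sum>n\<in>D k. W n / real n) \<le> (\<Sum>n\<in>D k. W n / 2 ^ k)"
        using W0 by (intro sum_mono divide_left_mono) (auto simp: D_def simp flip: of_nat_power intro!: mult_pos_pos order.strict_trans2[OF _ of_nat_mono])
      also have "\<dots> \<le> (\<Sum>n | n \<in> {z..2 ^ Suc k} \<and> Factorial_Ring.prime (n + 1). W n / 2 ^ k)"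
      proof (rule sum_mono2)
        have "z \<le> 2 ^ k" using a ak by linarith
        then show "D k \<subseteq> {n. n \<in> {z..2 ^ Suc k} \<and> Factorial_Ring.prime (n + 1)}" by (auto simp: D_def)
      qed (use W0 in auto)
      also have "\<dots> = (\<Sum>n | n \<in> {z..2 ^ Suc k} \<and> Factorial_Ring.prime (n + 1). W n) / 2 ^ k"
        by (rule sum_divide_distrib[symmetric])
      also have "\<dots> \<le> 10 * real (2 ^ Suc k) * exp (- (1 + 1/4) * V) / 2 ^ k"
      proof (rule divide_right_mono)
        have "M \<le> 2 ^ k" using a ak by linarith
        then have "z ^ (2 * K) \<le> 2 ^ Suc k" using z by simp
        then show "(\<Sum>n | n \<in> {z..2 ^ Suc k} \<and> Factorial_Ring.prime (n + 1). W n) \<le> 10 * real (2 ^ Suc k) * exp (- (1 + 1/4) * V)"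
          unfolding W_def V_def using K z by (intro sum_shifted_primes_le P) auto
      qed simp
      also have "\<dots> = 20 * exp (- 5 / 4 * V)" by simp
      finally show "(\<Sum>n\<in>D k. W n / real n) \<le> 20 * exp (- 5 / 4 * V)" .
    qed
    also have "\<dots> = real (b - a) * (20 * exp (- 5 / 4 * V))" by simp
    also have "\<dots> \<le> real b * (20 * exp (- 5 / 4 * V))" by (intro mult_right_mono) auto
    finally show ?thesis .
  qed
  finally have "real (card ?S) \<le> 10 * real x * exp (3/2 * V * l - V / 4) * (real b * (20 * exp (- 5 / 4 * V)))"
    by (simp add: mult_left_mono)
  also have "\<dots> = 200 * real x * real b * exp (3/2 * V * l - V / 4 + - 5 / 4 * V)"
    unfolding exp_add by simp
  also have "\<dots> \<le> 200 * real x * real b * exp (- 17 / 16 * V)"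
    using mult_left_mono[OF l(2) V0] by (intro mult_left_mono) auto
  finally show ?thesis .
qed

section \<open>Doubly exponential ranges of primes\<close>

text \<open>\<open>ln (ln n)\<close> varies by at most \<open>ln 2\<close> within such a range, so
  the sieving primes can be chosen once for all of it.\<close>

definition shifted_prime_multiples :: "nat \<Rightarrow> nat set" where
  "shifted_prime_multiples i =
     {d. \<exists>n. Factorial_Ring.prime (n + 1) \<and> 2 ^ 2 ^ i \<le> n \<and> n < 2 ^ 2 ^ Suc i \<and> n dvd d}"

text \<open>\<open>L\<close> and \<open>L'\<close> belong to sieving primes up to \<open>2 ^ 2 ^ (i - 4 * k)\<close> and \<open>2 ^ 2 ^ (i - k)\<close>. The cofactor \<open>m\<close> is
  split at \<open>2 ^ 2 ^ (i - 3 * k)\<close>: large enough to be sieved by the former, and small enough that the primes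
  counted using the latter outweigh the sum over \<open>m\<close>.\<close>

lemma card_shifted_prime_multiples_le_aux:
  fixes i k :: nat
  assumes k: "20 * i \<le> 2 ^ k" "4 * k + 2 \<le> i"
  defines "L \<equiv> real (i - 4 * k) * ln 2 - 2" and "L' \<equiv> real (i - k) * ln 2 - 2"
  shows "real (card (shifted_prime_multiples i \<inter> {1..x}))
     \<le> real x * (3 * exp (- 2 / 21 * L) + 200 * 2 ^ Suc i * exp (- 17 / 16 * L) + 10 * exp (- L') * (1 + 2 ^ (i - 3 * k)))"
proof -
  \<comment> \<open>Even, and at least nine times either reciprocal sum, as both sums are at most
    \<open>i\<close>.\<close>
  define K where "K = 10 * i"
  define M :: nat where "M = 2 ^ 2 ^ (i - 3 * k)"
  \<comment> \<open>The power \<open>2 * K = 20 * i\<close> costs at most \<open>k\<close> in the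
    inner exponent. Hence primes up to \<open>2 ^ 2 ^ (i - 4 * k)\<close> can sieve intervals of
    length \<open>M\<close>, and those up to \<open>2 ^ 2 ^ (i - k)\<close> intervals of length
    \<open>2 ^ 2 ^ i\<close>.\<close>
  have size: "(2 ^ 2 ^ e) ^ (2 * K) \<le> (2 :: nat) ^ 2 ^ (e + k)" for e
  proof -
    have "2 ^ e * (20 * i) \<le> 2 ^ e * 2 ^ k" using k by (intro mult_left_mono) auto
    then have "(2::nat) ^ (2 ^ e * (20 * i)) \<le> 2 ^ (2 ^ e * 2 ^ k)" by (intro power_increasing) auto
    then show ?thesis by (simp add: K_def power_add power_mult[symmetric])
  qed
  have mono: "(2::nat) ^ 2 ^ e \<le> 2 ^ 2 ^ f" if "e \<le> f" for e f :: nat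
    using that by (intro power_increasing) auto
  have two: "2 \<le> (2::nat) ^ 2 ^ e" for e using self_le_power[of 2 "2 ^ e"] by simp
  obtain P where P: "P \<subseteq> {..2 ^ 2 ^ (i - 4 * k)}" "\<And>q. q \<in> P \<Longrightarrow> Factorial_Ring.prime q"
    and V: "L \<le> (\<Sum>q\<in>P. 1 / real q)" "(\<Sum>q\<in>P. 1 / real q) \<le> real (i - 4 * k)"
    unfolding L_def using k by (rule_tac obtain_sieving_primes[of "i - 4 * k"]) auto
  obtain P' where P': "P' \<subseteq> {..2 ^ 2 ^ (i - k)}" "\<And>q. q \<in> P' \<Longrightarrow> Factorial_Ring.prime q"
    and V': "L' \<le> (\<Sum>q\<in>P'. 1 / real q)" "(\<Sum>q\<in>P'. 1 / real q) \<le> real (i - k)"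
    unfolding L'_def using k by (rule_tac obtain_sieving_primes[of "i - k"]) auto
  define V where "V = (\<Sum>q\<in>P. 1 / real q)"
  have fin: "finite P" using P(1) finite_subset by blast
  let ?A = "{d \<in> {1..x}. 3 / 2 * V < real (prime_count2 P d)}"
  let ?B = "{d \<in> {1..x}. (\<exists>n m. d = n * m \<and> Factorial_Ring.prime (n + 1) \<and> 2 ^ 2 ^ i \<le> n \<and> n < 2 ^ 2 ^ Suc i \<and> M \<le> m)
                       \<and> real (prime_count2 P d) \<le> 3 / 2 * V}"
  let ?C = "{d \<in> {1..x}. \<exists>n m. d = n * m \<and> Factorial_Ring.prime (n + 1) \<and> 2 ^ 2 ^ i \<le> n \<and> m \<le> 2 ^ 2 ^ (i - 3 * k)}"
  have K: "even K" "9 * (\<Sum>q\<in>P. 1 / real q) \<le> real K" "9 * (\<Sum>q\<in>P'. 1 / real q) \<le> real K"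
    using V(2) V'(2) k by (auto simp: K_def of_nat_diff)
  have "card (shifted_prime_multiples i \<inter> {1..x}) \<le> card (?A \<union> ?B \<union> ?C)"
  proof (rule card_mono)
    show "shifted_prime_multiples i \<inter> {1..x} \<subseteq> ?A \<union> ?B \<union> ?C"
    proof
      fix d assume d: "d \<in> shifted_prime_multiples i \<inter> {1..x}"
      then obtain n m where nm: "Factorial_Ring.prime (n + 1)" "2 ^ 2 ^ i \<le> n" "n < 2 ^ 2 ^ Suc i" "d = n * m"
        by (auto simp: shifted_prime_multiples_def elim: dvdE)
      have "3 / 2 * V < real (prime_count2 P d) \<or> real (prime_count2 P d) \<le> 3 / 2 * V" "M \<le> m \<or> m \<le> M" by linarith+
      then show "d \<in> ?A \<union> ?B \<union> ?C" using d nm unfolding M_def by blast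
    qed
  qed auto
  also have "\<dots> \<le> card ?A + card ?B + card ?C"
    using card_Un_le[of "?A \<union> ?B" ?C] card_Un_le[of ?A ?B] by linarith
  finally have "real (card (shifted_prime_multiples i \<inter> {1..x})) \<le> real (card ?A) + real (card ?B) + real (card ?C)"
    by linarith
  moreover have "real (card ?A) \<le> real x * (3 * exp (- 2 / 21 * L))"
  proof -
    have "real (card ?A) \<le> 3 * real x * exp (- 2 / 21 * V)"
      unfolding V_def by (rule card_prime_count2_gt_le[OF fin P(2)])
    also have "\<dots> \<le> 3 * real x * exp (- 2 / 21 * L)" using V(1) by (intro mult_left_mono) (auto simp: V_def)
    finally show ?thesis by (simp add: mult_ac)
  qed
  moreover have "real (card ?B) \<le> real x * (200 * 2 ^ Suc i * exp (- 17 / 16 * L))"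
  proof -
    have "(2 ^ 2 ^ (i - 4 * k)) ^ (2 * K) \<le> M" using size[of "i - 4 * k"] k by (simp add: M_def Suc_diff_le)
    then have "real (card ?B) \<le> 200 * real x * real (2 ^ Suc i) * exp (- 17 / 16 * V)"
      unfolding V_def using mono two K
      by (intro card_multiples_large_cofactor_le[OF P, where K = K]) (auto simp: M_def)
    also have "\<dots> \<le> 200 * real x * real (2 ^ Suc i) * exp (- 17 / 16 * L)"
      using V(1) by (intro mult_left_mono) (auto simp: V_def)
    finally show ?thesis by (simp add: mult_ac)
  qed
  moreover have "real (card ?C) \<le> real x * (10 * exp (- L') * (1 + 2 ^ (i - 3 * k)))"
  proof -
    have "real (card ?C) \<le> 10 * real x * exp (- (\<Sum>q\<in>P'. 1 / real q)) * (1 + real (2 ^ (i - 3 * k)))"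
      using mono two K size[of "i - k"] k
      by (intro card_multiples_small_cofactor_le[OF P', where K = K]) auto
    also have "\<dots> \<le> 10 * real x * exp (- L') * (1 + real (2 ^ (i - 3 * k)))"
      using V'(1) by (intro mult_right_mono mult_left_mono) auto
    finally show ?thesis by (simp add: mult_ac)
  qed
  ultimately show ?thesis by (simp only: distrib_left)
qed

text \<open>All three terms of the previous bound become geometric in \<open>i\<close> once
  \<open>k\<close> is a small fixed fraction of \<open>i\<close>; for large \<open>i\<close> this
  still leaves \<open>20 * i \<le> 2 ^ k\<close>.\<close>

lemma card_shifted_prime_multiples_le:
  "\<exists>i0. \<forall>i\<ge>i0. \<forall>x. real (card (shifted_prime_multiples i \<inter> {1..x})) \<le> 20000 * exp (- 1 / 200) ^ i * real x"
proof -
  have "\<forall>\<^sub>F k::nat in sequentially. 20 * (200 * (real k + 1)) \<le> 2 ^ k" by real_asymp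
  then obtain k0 where k0: "\<And>k. k0 \<le> k \<Longrightarrow> 20 * (200 * (real k + 1)) \<le> 2 ^ k"
    by (auto simp: eventually_sequentially)
  show ?thesis
  proof (intro exI[of _ "200 * (k0 + 1)"] allI impI)
    fix i x :: nat assume i: "200 * (k0 + 1) \<le> i"
    \<comment> \<open>\<open>k\<close> is linear in \<open>i\<close> because the small cofactors
      leave only \<open>exp (2 - 2 * B)\<close> with \<open>B = real k * ln 2\<close>. The fraction
      1/200 limits the loss \<open>4 * k\<close> in \<open>L\<close> to i/50, and 17/16 * 49/50 > 1
      still beats \<open>2 ^ Suc i\<close>.\<close>
    define k where "k = i div 200"
    have k: "k0 \<le> k" "200 * k \<le> i" "i < 200 * (k + 1)" "1 \<le> k" using i by (auto simp: k_def)
    have "real i < real (200 * (k + 1))" using k(3) by (simp only: of_nat_less_iff)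
    then have ik: "real i \<le> 200 * (real k + 1)" by simp
    have ki: "200 * real k \<le> real i" using k(2) by linarith
    from ik have "20 * real i \<le> 2 ^ k" using k0[OF k(1)] by linarith
    then have "real (20 * i) \<le> real (2 ^ k)" by simp
    then have 20: "20 * i \<le> 2 ^ k" by linarith
    define L where "L = real (i - 4 * k) * ln 2 - 2"
    define L' where "L' = real (i - k) * ln 2 - 2"
    define r where "r = exp (- 1 / 200 * real i)"
    have ln2: "2/3 \<le> ln (2::real)" "ln (2::real) \<le> 1" using ln2_ge_two_thirds ln_le_minus_one[of "2::real"] by auto
    have p2: "2 ^ j = exp (real j * ln 2)" for j :: nat by (simp add: exp_of_nat_mult)
    have i0: "0 \<le> real i" by simp
    define A B where "A = real i * ln 2" and "B = real k * ln 2"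
    have iln: "2/3 * real i \<le> real i * ln 2" using mult_left_mono[OF ln2(1), of "real i"] by simp
    have kln: "real k * ln 2 \<le> real i * ln 2 / 200" "real i * ln 2 / 200 - 1 \<le> real k * ln 2"
    proof -
      have "real k \<le> real i / 200" "real i / 200 - 1 \<le> real k" using ik ki by (auto simp: field_simps)
      from mult_right_mono[OF this(1), of "ln 2"] mult_right_mono[OF this(2), of "ln 2"]
      show "real k * ln 2 \<le> real i * ln 2 / 200" "real i * ln 2 / 200 - 1 \<le> real k * ln 2"
        using ln2 by (auto simp: algebra_simps)
    qed
    have L: "L = A - 4 * B - 2" and L': "L' = A - B - 2"
      using k by (auto simp: L_def L'_def A_def B_def of_nat_diff algebra_simps)
    note bounds = kln[folded A_def B_def] iln[folded A_def] i0
    have e: "exp (real n + y) \<le> 3 ^ n * exp y" for n and y :: real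
    proof -
      have "exp (real n + y) = exp 1 ^ n * exp y" by (simp add: exp_add flip: exp_of_nat_mult)
      also have "\<dots> \<le> 3 ^ n * exp y" using exp_1_le_3 by (intro mult_right_mono power_mono) auto
      finally show ?thesis .
    qed
    have 1: "exp (- 2 / 21 * L) \<le> 3 * r"
    proof -
      have "- 2 / 21 * L \<le> real 1 + - 1 / 200 * real i" unfolding L of_nat_1 of_nat_numeral using bounds by (simp add: field_simps)
      then show ?thesis using e[of 1 "- 1 / 200 * real i"] by (simp add: r_def order.trans[OF iffD2[OF exp_le_cancel_iff]])
    qed
    have 2: "2 ^ Suc i * exp (- 17 / 16 * L) \<le> 54 * r"
    proof -
      have "2 ^ Suc i * exp (- 17 / 16 * L) = 2 * exp (A + - 17 / 16 * L)"
        by (simp only: exp_add A_def p2[symmetric]) simp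
      also have "A + - 17 / 16 * L \<le> real 3 + - 1 / 200 * real i" unfolding L of_nat_1 of_nat_numeral using bounds by (simp add: field_simps)
      then have "2 * exp (A + - 17 / 16 * L) \<le> 2 * exp (real 3 + - 1 / 200 * real i)" by simp
      also have "\<dots> \<le> 2 * (3 ^ 3 * exp (- 1 / 200 * real i))" by (intro mult_left_mono e) auto
      finally show ?thesis by (simp add: r_def)
    qed
    have 3: "exp (- L') * (1 + 2 ^ (i - 3 * k)) \<le> 162 * r"
    proof -
      have "exp (- L') * (1 + 2 ^ (i - 3 * k)) \<le> exp (- L') * (2 * 2 ^ (i - 3 * k))"
        by (intro mult_left_mono) auto
      also have "\<dots> = 2 * exp (real (i - 3 * k) * ln 2 + - L')"
        by (simp only: exp_add p2[symmetric]) simp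
      also have "real (i - 3 * k) * ln 2 + - L' = 2 - 2 * B"
        using k by (simp add: L' A_def B_def of_nat_diff algebra_simps)
      also have "2 - 2 * B \<le> real 4 + - 1 / 200 * real i" unfolding of_nat_numeral using bounds by (simp add: field_simps)
      then have "2 * exp (2 - 2 * B) \<le> 2 * exp (real 4 + - 1 / 200 * real i)" by simp
      also have "\<dots> \<le> 2 * (3 ^ 4 * exp (- 1 / 200 * real i))" by (intro mult_left_mono e) auto
      finally show ?thesis by (simp add: r_def)
    qed
    have "real (card (shifted_prime_multiples i \<inter> {1..x}))
      \<le> real x * (3 * exp (- 2 / 21 * L) + 200 * 2 ^ Suc i * exp (- 17 / 16 * L) + 10 * exp (- L') * (1 + 2 ^ (i - 3 * k)))"
      unfolding L_def L'_def using k by (intro card_shifted_prime_multiples_le_aux 20) auto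
    \<comment> \<open>The three bounds add up to 9 + 10800 + 1620 = 12429 times
      \<open>r\<close>.\<close>
    also have "\<dots> \<le> real x * (20000 * r)"
    proof (rule mult_left_mono)
      have "0 \<le> r" by (simp add: r_def)
      then show "3 * exp (- 2 / 21 * L) + 200 * 2 ^ Suc i * exp (- 17 / 16 * L) + 10 * exp (- L') * (1 + 2 ^ (i - 3 * k)) \<le> 20000 * r"
        using 1 2 3 by simp
    qed simp
    also have "r = exp (- 1 / 200) ^ i" by (simp add: r_def mult.commute flip: exp_of_nat_mult)
    finally show "real (card (shifted_prime_multiples i \<inter> {1..x})) \<le> 20000 * exp (- 1 / 200) ^ i * real x"
      by (simp add: mult_ac)
  qed
qed

text \<open>A prime above \<open>2 ^ 2 ^ I\<close> falls into a range of index at least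
  \<open>I\<close>, so a union bound over the ranges leaves a geometric tail, uniformly in
  \<open>x\<close>.\<close>

theorem multiples_of_large_shifted_primes_sparse:
  assumes "0 < \<epsilon>"
  shows "\<exists>T::nat. \<forall>x. real (card {d \<in> {1..x}. \<exists>p>T. Factorial_Ring.prime p \<and> p - 1 dvd d}) \<le> \<epsilon> * real x"
proof -
  define \<rho> where "\<rho> = exp (- 1 / 200 :: real)"
  have \<rho>: "0 < \<rho>" "\<rho> < 1" by (auto simp: \<rho>_def)
  obtain i0 where i0: "\<And>i x. i0 \<le> i \<Longrightarrow> real (card (shifted_prime_multiples i \<inter> {1..x})) \<le> 20000 * \<rho> ^ i * real x"
    unfolding \<rho>_def using card_shifted_prime_multiples_le by blast
  have "(\<lambda>i. 20000 * \<rho> ^ i / (1 - \<rho>)) \<longlonglongrightarrow> 20000 * 0 / (1 - \<rho>)"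
    using \<rho> by (intro tendsto_intros LIMSEQ_realpow_zero) auto
  then have "\<forall>\<^sub>F i in sequentially. 20000 * \<rho> ^ i / (1 - \<rho>) < \<epsilon>"
    using assms by (intro order_tendstoD) auto
  then obtain i1 where i1: "\<And>i. i1 \<le> i \<Longrightarrow> 20000 * \<rho> ^ i / (1 - \<rho>) < \<epsilon>" by (auto simp: eventually_sequentially)
  define I where "I = max i0 i1"
  show ?thesis
  proof (intro exI[of _ "2 ^ 2 ^ I"] allI)
    fix x :: nat
    let ?S = "{d \<in> {1..x}. \<exists>p>2 ^ 2 ^ I. Factorial_Ring.prime p \<and> p - 1 dvd d}"
    have "?S \<subseteq> (\<Union>i\<in>{I..<I + x}. shifted_prime_multiples i \<inter> {1..x})"
    proof
      fix d assume d: "d \<in> ?S"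
      then obtain p where p: "2 ^ 2 ^ I < p" "Factorial_Ring.prime p" "p - 1 dvd d" by auto
      define n where "n = p - 1"
      have n: "2 ^ 2 ^ I \<le> n" "Factorial_Ring.prime (n + 1)" "n dvd d" using p prime_gt_0_nat[of p] by (auto simp: n_def)
      have "n \<le> x" using d n dvd_imp_le[of n d] by auto
      have "1 \<le> n" using n(1) one_le_power[of "2::nat" "2 ^ I"] by linarith
      then obtain a where a: "2 ^ a \<le> n" "n < 2 ^ (a + 1)" using ex_power_ivl1[of 2 n] by auto
      have "2 ^ 2 ^ I < (2::nat) ^ (a + 1)" using n a by linarith
      then have "2 ^ I < a + 1" by (rule power_less_imp_less_exp[rotated]) simp
      then have aI: "2 ^ I \<le> a" by simp
      then have "1 \<le> a" using one_le_power[of "2::nat" I] by linarith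
      then obtain i where i: "2 ^ i \<le> a" "a < 2 ^ (i + 1)" using ex_power_ivl1[of 2 a] by auto
      have "2 ^ I < (2::nat) ^ (i + 1)" using i aI by linarith
      then have "I < i + 1" by (rule power_less_imp_less_exp[rotated]) simp
      then have "I \<le> i" by simp
      \<comment> \<open>Only finitely many ranges meet the interval up to \<open>x\<close>; the
        crude chain \<open>i < 2 ^ i \<le> a < 2 ^ a \<le> n \<le> x\<close> suffices for the upper
        index \<open>I + x\<close>.\<close>
      moreover have "i < x"
      proof -
        have "i < 2 ^ i" by (rule less_exp)
        also have "\<dots> \<le> a" by (rule i)
        also have "a < 2 ^ a" by (rule less_exp)
        finally show ?thesis using a \<open>n \<le> x\<close> by linarith
      qed
      moreover have "2 ^ 2 ^ i \<le> n" using power_increasing[OF i(1), of "2::nat"] a by linarith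
      moreover have "n < 2 ^ 2 ^ Suc i" using power_increasing[of "a + 1" "2 ^ (i + 1)" "2::nat"] a i by simp
      ultimately show "d \<in> (\<Union>i\<in>{I..<I + x}. shifted_prime_multiples i \<inter> {1..x})"
        using n d by (auto simp: shifted_prime_multiples_def intro!: bexI[of _ i])
    qed
    then have "card ?S \<le> card (\<Union>i\<in>{I..<I + x}. shifted_prime_multiples i \<inter> {1..x})" by (intro card_mono) auto
    also have "\<dots> \<le> (\<Sum>i\<in>{I..<I + x}. card (shifted_prime_multiples i \<inter> {1..x}))" by (intro card_UN_le) auto
    finally have "real (card ?S) \<le> (\<Sum>i\<in>{I..<I + x}. real (card (shifted_prime_multiples i \<inter> {1..x})))"
      by (simp flip: of_nat_sum)
    also have "\<dots> \<le> (\<Sum>i\<in>{I..<I + x}. 20000 * \<rho> ^ i * real x)"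
      using i0 by (intro sum_mono) (auto simp: I_def)
    also have "\<dots> = 20000 * real x * (\<Sum>i\<in>{I..<I + x}. \<rho> ^ i)"
      unfolding sum_distrib_left by (intro sum.cong refl) simp
    also have "(\<Sum>i\<in>{I..<I + x}. \<rho> ^ i) = \<rho> ^ I * (\<Sum>i<x. \<rho> ^ i)"
      using sum.shift_bounds_nat_ivl[of "\<lambda>i. \<rho> ^ i" 0 I x]
      by (simp add: sum_distrib_left power_add add.commute mult.commute atLeast0LessThan)
    also have "(\<Sum>i<x. \<rho> ^ i) = (1 - \<rho> ^ x) / (1 - \<rho>)" using \<rho> by (simp add: sum_gp_strict)
    also have "20000 * real x * (\<rho> ^ I * ((1 - \<rho> ^ x) / (1 - \<rho>))) \<le> 20000 * real x * (\<rho> ^ I * (1 / (1 - \<rho>)))"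
      using \<rho> by (intro mult_left_mono divide_right_mono) auto
    also have "\<dots> = 20000 * \<rho> ^ I / (1 - \<rho>) * real x" by simp
    also have "\<dots> \<le> \<epsilon> * real x" using i1[of I] by (intro mult_right_mono) (auto simp: I_def)
    finally show "real (card ?S) \<le> \<epsilon> * real x" .
  qed
qed

subsection \<open>Torsion\<close>

lemma upper_density_le:
  assumes "\<And>x. real (card (S \<inter> {1..x})) \<le> \<epsilon> * real x" "0 \<le> \<epsilon>"
  shows "upper_density S \<le> ereal \<epsilon>"
  unfolding upper_density_def
proof (rule Limsup_bounded, rule always_eventually, rule allI)
  fix x :: nat
  \<comment> \<open>At \<open>x = 0\<close> the quotient is 0 by convention, and
    \<open>0 \<le> \<epsilon>\<close> settles this case.\<close>
  show "ereal (real (card (S \<inter> {1..x})) / real x) \<le> ereal \<epsilon>"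
    using assms(1)[of x] assms(2) by (cases "x = 0") (auto simp: divide_le_eq)
qed

lemma upper_density_mono:
  assumes "S \<subseteq> S'"
  shows "upper_density S \<le> upper_density S'"
  unfolding upper_density_def
proof (rule Limsup_mono, rule always_eventually, rule allI)
  fix x :: nat
  have "card (S \<inter> {1..x}) \<le> card (S' \<inter> {1..x})" using assms by (intro card_mono) auto
  then show "ereal (real (card (S \<inter> {1..x})) / real x) \<le> ereal (real (card (S' \<inter> {1..x})) / real x)"
    by (simp add: divide_right_mono)
qed

lemma card_multiples_le: "0 < r \<Longrightarrow> real (card {d \<in> {1..x}. r dvd d}) \<le> real x / real r"
  using sum_multiples[of r "\<lambda>_. 1" x] of_nat_div_le_of_nat[where 'a=real, of x r]
  by (simp add: Int_def)

lemma (in group) exists_ord_eq_of_dvd: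
  assumes "finite (carrier G)" "x \<in> carrier G" "j dvd ord x"
  shows "\<exists>y\<in>carrier G. ord y = j"
proof -
  have o: "0 < ord x" using ord_ge_1[OF assms(1,2)] by simp
  obtain k where k: "ord x = j * k" using assms(3) by (elim dvdE)
  have "0 < k" "0 < j" using o k by (auto intro: gr0I)
  then have "ord (x [^] k) = j" using ord_pow_gen[OF assms(2), of k] k by simp
  then show ?thesis using assms(2) by blast
qed

text \<open>Multiplicities are compared prime by prime: primes outside \<open>S\<close> do not
  divide \<open>m\<close>, and each \<open>p\<close> in \<open>S\<close> divides it fewer than
  \<open>e p\<close> times. This supplies a common multiple of all element orders.\<close>

lemma dvd_prod_prime_powers:
  fixes m :: nat
  assumes "m \<noteq> 0" "finite S" "\<And>p. p \<in> S \<Longrightarrow> Factorial_Ring.prime p"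
    "\<And>p. Factorial_Ring.prime p \<Longrightarrow> p dvd m \<Longrightarrow> p \<in> S" "\<And>p. p \<in> S \<Longrightarrow> \<not> p ^ e p dvd m"
  shows "m dvd (\<Prod>p\<in>S. p ^ e p)"
proof (rule multiplicity_le_imp_dvd)
  fix p :: nat assume p: "Factorial_Ring.prime p"
  show "multiplicity p m \<le> multiplicity p (\<Prod>p\<in>S. p ^ e p)"
  proof (cases "p \<in> S")
    case True
    then have "\<not> e p \<le> multiplicity p m"
      using assms(5)[OF True] multiplicity_dvd'[of "e p" p m] by blast
    then show ?thesis using multiplicity_prod_prime_powers[of S p e] assms p True by simp
  next
    case False
    then have "\<not> p dvd m" using assms(4)[OF p] by blast
    then show ?thesis by (simp add: not_dvd_imp_multiplicity_0)
  qed
qed (use assms in auto)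

section \<open>Bounded torsion outside sparse sets of degrees\<close>

theorem theorem3p2:
  fixes Fam :: "'a set"
    and deg :: "'a \<Rightarrow> nat"
    and dim :: "'a \<Rightarrow> nat"
    and tors :: "'a \<Rightarrow> 'b monoid"
  assumes AV: "\<And>A. A \<in> Fam \<Longrightarrow> av_torsion_group (tors A) (dim A)"
    and deg_pos: "\<And>A. A \<in> Fam \<Longrightarrow> deg A > 0"
    and P1: "\<forall>p N. Factorial_Ring.prime (p::nat) \<and> N > 0 \<longrightarrow>
               (\<exists>n>0. \<forall>A\<in>Fam. has_point_of_order (tors A) (p ^ n) \<longrightarrow> p ^ N dvd deg A)"
    and P2: "\<exists>c>0. \<forall>p::nat. Factorial_Ring.prime p \<longrightarrow>
               (\<forall>A\<in>Fam. has_point_of_order (tors A) p \<longrightarrow> (p - 1) dvd c * deg A)"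
  shows "(\<forall>\<epsilon>::real. \<epsilon> > 0 \<longrightarrow> (\<exists>B::nat. B > 0 \<and>
            upper_density {d. d > 0 \<and> (\<exists>A\<in>Fam. deg A = d \<and> group_exponent (tors A) \<ge> B)}
              \<le> ereal \<epsilon>))
       \<and> (\<forall>g::nat. g > 0 \<longrightarrow> (\<forall>\<epsilon>::real. \<epsilon> > 0 \<longrightarrow> (\<exists>B::nat. B > 0 \<and>
            upper_density {d. d > 0 \<and> (\<exists>A\<in>Fam. dim A = g \<and> deg A = d \<and>
                                     card (carrier (tors A)) \<ge> B)}
              \<le> ereal \<epsilon>)))"
proof -
  \<comment> \<open>Both assertions reduce to element orders: off a set of degrees of small upper
    density, one \<open>M\<close> is a multiple of every order. The dimension enters only
    afterwards, in (b).\<close>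
  have bounded: "\<exists>M>0. \<exists>S. upper_density S \<le> ereal \<epsilon> \<and>
      (\<forall>A\<in>Fam. deg A \<notin> S \<longrightarrow> (\<forall>x\<in>carrier (tors A). group.ord (tors A) x dvd M))" if \<epsilon>: "0 < \<epsilon>" for \<epsilon> :: real
  proof -
    obtain c where c: "0 < c" and dvd_c: "\<And>p A. Factorial_Ring.prime p \<Longrightarrow> A \<in> Fam \<Longrightarrow>
        has_point_of_order (tors A) p \<Longrightarrow> (p - 1) dvd c * deg A"
      using P2 by blast
    \<comment> \<open>(P2) makes \<open>c * d\<close> rather than \<open>d\<close> a multiple of
      \<open>p - 1\<close>, and \<open>c * d\<close> runs up to \<open>c * x\<close>; the proportion
      \<open>\<epsilon> / (2 * real c)\<close> there amounts to half of
      \<open>\<epsilon> * real x\<close>.\<close>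
    obtain T where T: "\<And>x. real (card {d \<in> {1..x}. \<exists>p>T. Factorial_Ring.prime p \<and> p - 1 dvd d}) \<le> \<epsilon> / (2 * real c) * real x"
      using multiples_of_large_shifted_primes_sparse[of "\<epsilon> / (2 * real c)"] \<epsilon> c by auto
    \<comment> \<open>At most \<open>T\<close> primes are involved, and the multiples of each
      \<open>p ^ Suc N\<close> have density at most \<open>1 / 2 ^ N\<close>; this \<open>N\<close>
      keeps the total below \<open>\<epsilon> / 2\<close>. Using \<open>Suc N\<close> keeps the
      exponent in (P1) positive.\<close>
    obtain N where N: "2 * real T / \<epsilon> < 2 ^ N" using real_arch_pow[of 2 "2 * real T / \<epsilon>"] by auto
    define Q where "Q = {p. Factorial_Ring.prime p \<and> p \<le> T}"
    have finQ: "finite Q" by (simp add: Q_def)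
    have cardQ: "card Q \<le> T"
    proof -
      have "Q \<subseteq> {1..T}" using prime_ge_1_nat by (auto simp: Q_def)
      then show ?thesis using card_mono[of "{1..T}" Q] by simp
    qed
    have "\<forall>p\<in>Q. \<exists>n. \<forall>A\<in>Fam. has_point_of_order (tors A) (p ^ n) \<longrightarrow> p ^ Suc N dvd deg A"
      using P1 unfolding Q_def by blast
    then obtain n where n: "\<And>p A. p \<in> Q \<Longrightarrow> A \<in> Fam \<Longrightarrow> has_point_of_order (tors A) (p ^ n p) \<Longrightarrow> p ^ Suc N dvd deg A"
      by metis
    define S1 where "S1 = {d. \<exists>p>T. Factorial_Ring.prime p \<and> p - 1 dvd c * d}"
    define S2 where "S2 = {d. \<exists>p\<in>Q. p ^ Suc N dvd d}"
    define M where "M = (\<Prod>p\<in>Q. p ^ n p)"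
    have "0 < M" unfolding M_def using prime_gt_0_nat by (intro prod_pos) (auto simp: Q_def)
    moreover have "upper_density (S1 \<union> S2) \<le> ereal \<epsilon>"
    proof (rule upper_density_le)
      fix x
      have "card (S1 \<inter> {1..x}) \<le> card {d \<in> {1..c * x}. \<exists>p>T. Factorial_Ring.prime p \<and> p - 1 dvd d}"
        using c by (intro card_inj_on_le[of "(*) c"]) (auto simp: inj_on_def S1_def Suc_le_eq)
      also have "real \<dots> \<le> \<epsilon> / (2 * real c) * real (c * x)" by (rule T)
      finally have 1: "real (card (S1 \<inter> {1..x})) \<le> \<epsilon> / 2 * real x" using c by simp
      have "S2 \<inter> {1..x} = (\<Union>p\<in>Q. {d \<in> {1..x}. p ^ Suc N dvd d})" by (auto simp: S2_def)
      then have "card (S2 \<inter> {1..x}) \<le> (\<Sum>p\<in>Q. card {d \<in> {1..x}. p ^ Suc N dvd d})"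
        using card_UN_le[OF finQ] by simp
      then have "real (card (S2 \<inter> {1..x})) \<le> (\<Sum>p\<in>Q. real (card {d \<in> {1..x}. p ^ Suc N dvd d}))"
        by (simp flip: of_nat_sum)
      also have "\<dots> \<le> (\<Sum>p\<in>Q. real x / 2 ^ N)"
      proof (rule sum_mono)
        fix p assume "p \<in> Q"
        then have p: "2 \<le> p" using prime_ge_2_nat by (auto simp: Q_def)
        have "(2::real) ^ N \<le> 2 ^ Suc N" by simp
        also have "\<dots> \<le> real p ^ Suc N" using p by (intro power_mono) auto
        finally have "2 ^ N \<le> real (p ^ Suc N)" by simp
        moreover have "real (card {d \<in> {1..x}. p ^ Suc N dvd d}) \<le> real x / real (p ^ Suc N)"
          using p by (intro card_multiples_le) auto
        ultimately show "real (card {d \<in> {1..x}. p ^ Suc N dvd d}) \<le> real x / 2 ^ N"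
          by (smt (verit) divide_left_mono of_nat_0_le_iff mult_pos_pos zero_less_power)
      qed
      also have "\<dots> = real (card Q) / 2 ^ N * real x" by simp
      also have "\<dots> \<le> \<epsilon> / 2 * real x"
      proof (rule mult_right_mono)
        have "2 * real (card Q) \<le> 2 * real T" using cardQ by simp
        also have "\<dots> \<le> \<epsilon> * 2 ^ N" using N \<epsilon> by (simp add: field_simps)
        finally show "real (card Q) / 2 ^ N \<le> \<epsilon> / 2" by (simp add: field_simps)
      qed simp
      finally have 2: "real (card (S2 \<inter> {1..x})) \<le> \<epsilon> / 2 * real x" .
      have "card ((S1 \<union> S2) \<inter> {1..x}) \<le> card (S1 \<inter> {1..x}) + card (S2 \<inter> {1..x})"
        by (simp add: Int_Un_distrib2 card_Un_le)
      then show "real (card ((S1 \<union> S2) \<inter> {1..x})) \<le> \<epsilon> * real x" using 1 2 by (simp add: field_simps)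
    qed (use \<epsilon> in simp)
    moreover have "group.ord (tors A) x dvd M"
      if A: "A \<in> Fam" "deg A \<notin> S1 \<union> S2" and x: "x \<in> carrier (tors A)" for A x
    proof -
      interpret comm_group "tors A" using AV[OF A(1)] by (simp add: av_torsion_group_def)
      have fin: "finite (carrier (tors A))" using AV[OF A(1)] by (simp add: av_torsion_group_def)
      have pt: "has_point_of_order (tors A) j" if "j dvd ord x" for j
        unfolding has_point_of_order_def using exists_ord_eq_of_dvd[OF fin x that] .
      \<comment> \<open>A divisor of an order is itself the order of a point. A prime divisor above
        \<open>T\<close> would thus put the degree into \<open>S1\<close> by (P2), and a divisor
        \<open>p ^ n p\<close> with \<open>p\<close> in \<open>Q\<close> would put it into
        \<open>S2\<close> by (P1).\<close>
      show ?thesis unfolding M_def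
      proof (rule dvd_prod_prime_powers[OF _ finQ])
        show "ord x \<noteq> 0" using ord_ge_1[OF fin x] by simp
        show "p \<in> Q" if p: "Factorial_Ring.prime p" "p dvd ord x" for p
          using dvd_c[OF p(1) A(1) pt[OF p(2)]] A(2) p(1) by (auto simp: Q_def S1_def not_le)
        show "\<not> p ^ n p dvd ord x" if p: "p \<in> Q" for p
          using n[OF p A(1) pt] A(2) p by (auto simp: S2_def)
      qed (simp add: Q_def)
    qed
    ultimately show ?thesis by blast
  qed
  show ?thesis
  proof (intro conjI allI impI)
    fix \<epsilon> :: real assume "0 < \<epsilon>"
    then obtain M S where M: "0 < M" "upper_density S \<le> ereal \<epsilon>"
      and ord: "\<And>A x. A \<in> Fam \<Longrightarrow> deg A \<notin> S \<Longrightarrow> x \<in> carrier (tors A) \<Longrightarrow> group.ord (tors A) x dvd M"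
      using bounded by meson
    have "deg A \<in> S" if "A \<in> Fam" "M + 1 \<le> group_exponent (tors A)" for A
    proof (rule ccontr)
      assume "deg A \<notin> S"
      then have "group_exponent (tors A) dvd M"
        unfolding group_exponent_def using ord that(1) by (intro Lcm_least) auto
      then show False using M(1) that(2) by (auto dest: dvd_imp_le)
    qed
    then have "{d. 0 < d \<and> (\<exists>A\<in>Fam. deg A = d \<and> M + 1 \<le> group_exponent (tors A))} \<subseteq> S" by auto
    then show "\<exists>B>0. upper_density {d. 0 < d \<and> (\<exists>A\<in>Fam. deg A = d \<and> B \<le> group_exponent (tors A))} \<le> ereal \<epsilon>"
      using M(2) by (intro exI[of _ "M + 1"]) (auto intro: order.trans[OF upper_density_mono])
  next
    fix g :: nat and \<epsilon> :: real assume "0 < \<epsilon>"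
    then obtain M S where M: "0 < M" "upper_density S \<le> ereal \<epsilon>"
      and ord: "\<And>A x. A \<in> Fam \<Longrightarrow> deg A \<notin> S \<Longrightarrow> x \<in> carrier (tors A) \<Longrightarrow> group.ord (tors A) x dvd M"
      using bounded by meson
    have "deg A \<in> S" if A: "A \<in> Fam" "M ^ (2 * dim A) + 1 \<le> card (carrier (tors A))" for A
    proof (rule ccontr)
      assume S: "deg A \<notin> S"
      interpret comm_group "tors A" using AV[OF A(1)] by (simp add: av_torsion_group_def)
      \<comment> \<open>Every element is killed by \<open>M\<close>, so the whole group is its own
        \<open>M\<close>-torsion, to which the bound in \<open>av_torsion_group\<close>
        applies.\<close>
      have "{x \<in> carrier (tors A). x [^]\<^bsub>tors A\<^esub> M = \<one>\<^bsub>tors A\<^esub>} = carrier (tors A)"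
        using ord[OF A(1) S] pow_eq_id by auto
      then have "card (carrier (tors A)) \<le> M ^ (2 * dim A)"
        using AV[OF A(1)] M(1) unfolding av_torsion_group_def by metis
      then show False using A(2) by simp
    qed
    then have "{d. 0 < d \<and> (\<exists>A\<in>Fam. dim A = g \<and> deg A = d \<and> M ^ (2 * g) + 1 \<le> card (carrier (tors A)))} \<subseteq> S" by auto
    then show "\<exists>B>0. upper_density {d. 0 < d \<and> (\<exists>A\<in>Fam. dim A = g \<and> deg A = d \<and> B \<le> card (carrier (tors A)))} \<le> ereal \<epsilon>"
      using M(2) by (intro exI[of _ "M ^ (2 * g) + 1"]) (auto intro: order.trans[OF upper_density_mono])
  qed
qed

end
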